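(* Let $p,q\ge1$ be integers and $\sigma_1,\sigma_2\in\{\pm1\}$ with $(p,\sigma_1)\neq(1,1)$. If the weight $w=p+q$ and the integer $\frac{1+\sigma_1\sigma_2}{2}$ have the same parity, then the double $t$-value $t(p,q;\sigma_1,\sigma_2)$ and the double $\tilde t$-value $\tilde t(p,q;\sigma_1,\sigma_2)$ are reducible to combinations of (i.e. are polynomials with rational coefficients in) $\pi$, $\ln 2$, $G$, the zeta values $\zeta(3),\zeta(5),\ldots$, and the Dirichlet beta values $\beta(4),\beta(6),\ldots$.
   Context: $t(p,q;\sigma_1,\sigma_2)=\sum_{n_1>n_2\ge1}\frac{\sigma_1^{n_1}\sigma_2^{n_2}}{(2n_1-1)^{p}(2n_2-1)^{q}}$ and $\tilde t(p,q;\sigma_1,\sigma_2)=\sum_{n_1>n_2\ge1}\frac{\sigma_1^{n_1}\sigma_2^{n_2}}{(n_1-1/2)^{p}(n_2-1/2)^{q}}=2^{p+q}t(p,q;\sigma_1,\sigma_2)$, the sum over $n_1$ being outermost (limit of partial sums). $\beta(s)=\sum_{n\ge1}\frac{(-1)^{n-1}}{(2n-1)^s}$ is the Dirichlet beta function and $G=\beta(2)$ is Catalan's constant. *)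

theory Defs
  imports Complex_Main "HOL-Library.Poly_Mapping"
begin

text \<open>
  The double series are iterated: the sum over \<open>n1\<close> is outermost and is the limit of its partial
  sums, since the series need not converge absolutely.  The outer index formally starts at \<open>0\<close>, but
  for \<open>n1 = 0\<close> and \<open>n1 = 1\<close> the inner sum is empty.  \<^const>\<open>suminf\<close> is written out because
  \<^theory>\<open>HOL-Library.Poly_Mapping\<close> loads a second meaning of the binder notation (\<^const>\<open>Sum_any\<close>).
\<close>

definition double_t :: "nat \<Rightarrow> nat \<Rightarrow> int \<Rightarrow> int \<Rightarrow> real" where
  "double_t p q \<sigma>1 \<sigma>2 =
     suminf (\<lambda>n1. \<Sum>n2=1..<n1. of_int \<sigma>1 ^ n1 * of_int \<sigma>2 ^ n2
                         / ((2 * real n1 - 1) ^ p * (2 * real n2 - 1) ^ q))"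

definition double_t_tilde :: "nat \<Rightarrow> nat \<Rightarrow> int \<Rightarrow> int \<Rightarrow> real" where
  "double_t_tilde p q \<sigma>1 \<sigma>2 =
     suminf (\<lambda>n1. \<Sum>n2=1..<n1. of_int \<sigma>1 ^ n1 * of_int \<sigma>2 ^ n2
                         / ((real n1 - 1/2) ^ p * (real n2 - 1/2) ^ q))"

text \<open>In the following two series the summation index \<open>n \<ge> 1\<close> of the usual definition is \<open>Suc k\<close>.\<close>

definition zeta_value :: "nat \<Rightarrow> real" where
  "zeta_value s = suminf (\<lambda>k. 1 / real (Suc k) ^ s)"

definition dirichlet_beta :: "nat \<Rightarrow> real" where
  "dirichlet_beta s = suminf (\<lambda>k. (-1) ^ k / (2 * real (Suc k) - 1) ^ s)"

definition catalan_const :: real where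
  "catalan_const = dirichlet_beta 2"

text \<open>
  Multivariate polynomials with rational coefficients and variables of type \<open>'v\<close> are elements of
  \<open>('v \<Rightarrow>\<^sub>0 nat) \<Rightarrow>\<^sub>0 rat\<close>: finitely supported maps from monomials (exponent vectors) to coefficients.
\<close>

definition eval_rat_mpoly :: "('v \<Rightarrow> real) \<Rightarrow> (('v \<Rightarrow>\<^sub>0 nat) \<Rightarrow>\<^sub>0 rat) \<Rightarrow> real" where
  "eval_rat_mpoly x P =
     (\<Sum>m\<in>Poly_Mapping.keys P. of_rat (Poly_Mapping.lookup P m) *
        (\<Prod>v\<in>Poly_Mapping.keys m. x v ^ Poly_Mapping.lookup m v))"

text \<open>
  Each real number in \<open>S\<close> serves as the name of its own variable, so the second condition says that
  \<open>P\<close> only involves variables from \<open>S\<close>, and evaluation substitutes each variable by its value.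
\<close>

definition rat_polynomial_in :: "real set \<Rightarrow> real \<Rightarrow> bool" where
  "rat_polynomial_in S y \<longleftrightarrow>
     (\<exists>P :: (real \<Rightarrow>\<^sub>0 nat) \<Rightarrow>\<^sub>0 rat.
        y = eval_rat_mpoly (\<lambda>v. v) P \<and>
        (\<forall>m\<in>Poly_Mapping.keys P. Poly_Mapping.keys m \<subseteq> S))"

definition t_generators :: "real set" where
  "t_generators =
     {pi, ln 2, catalan_const}
     \<union> {zeta_value (2 * k + 1) | k. k \<ge> 1}
     \<union> {dirichlet_beta (2 * k) | k. k \<ge> 2}"

end

theory Submission
  imports Defs "HOL-Analysis.Harmonic_Numbers" "HOL-Analysis.Gamma_Function"
begin

text \<open>
  Write \<open>x\<^sub>n = n - 1/2\<close>, \<open>w = p + q\<close>, and let \<open>T(p,q)\<close>, \<open>A\<close>, \<open>B\<close>, \<open>C\<close> be the double sum, the two single sums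
  and the diagonal sum, all truncated at \<open>N\<close>.  The bilateral sum of
  \<open>s1^n s2^m / (x\<^sub>n^p x\<^sub>m^q)\<close> over \<open>1 - N \<le> m < n \<le> N\<close> is evaluated in two ways.  The reflection
  \<open>n \<mapsto> 1 - n\<close> turns it into \<open>T(p,q) + s1 s2 (-1)^w T(q,p) + s2 (-1)^q A B\<close>, whose second sign
  is \<open>-1\<close> exactly under the parity hypothesis; together with the stuffle relation
  \<open>T(p,q) + T(q,p) + C = A B\<close> this determines \<open>T(p,q)\<close>.  On the other hand, partial fractions with
  respect to \<open>k = n - m\<close> reduce the bilateral sum to products of a single sum over \<open>k\<close> and a single
  sum over half-integers, up to an error that vanishes as \<open>N \<rightarrow> \<infinity>\<close>.  Keeping all sums finite avoids
  every question of conditional convergence.  With the opposite parity, the same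
  identity gives \<open>C\<close> instead, which yields the even zeta and odd beta values recursively.
\<close>

subsection \<open>Rational polynomials in a set of real numbers\<close>

definition monomial_value :: "(real \<Rightarrow>\<^sub>0 nat) \<Rightarrow> real" where
  "monomial_value m = (\<Prod>v\<in>Poly_Mapping.keys m. v ^ Poly_Mapping.lookup m v)"

text \<open>Variables outside the support enter as \<open>v ^ 0 = 1\<close>, so monomials with
  different supports can be compared factor by factor.\<close>

lemma monomial_value_superset:
  assumes "finite V" "Poly_Mapping.keys m \<subseteq> V"
  shows "monomial_value m = (\<Prod>v\<in>V. v ^ Poly_Mapping.lookup m v)"
  unfolding monomial_value_def
  using assms by (intro prod.mono_neutral_left) (auto simp: in_keys_iff)

lemma monomial_value_add:
  "monomial_value (m + n) = monomial_value m * monomial_value n"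
proof -
  let ?V = "Poly_Mapping.keys m \<union> Poly_Mapping.keys n"
  have "Poly_Mapping.keys (m + n) \<subseteq> ?V" by (rule Poly_Mapping.keys_add)
  then show ?thesis
    by (simp add: monomial_value_superset[of ?V] lookup_add power_add prod.distrib)
qed

text \<open>Absent monomials have coefficient 0; hence \<open>P\<close>, \<open>Q\<close> and
  \<open>P + Q\<close> can share one index set even if coefficients cancel in the sum.\<close>

lemma eval_rat_mpoly_superset:
  assumes "finite M" "Poly_Mapping.keys P \<subseteq> M"
  shows "eval_rat_mpoly (\<lambda>v. v) P = (\<Sum>m\<in>M. of_rat (Poly_Mapping.lookup P m) * monomial_value m)"
  unfolding eval_rat_mpoly_def monomial_value_def
  using assms by (intro sum.mono_neutral_left) (auto simp: in_keys_iff)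

lemma rat_polynomial_in_monomial:
  assumes "Poly_Mapping.keys m \<subseteq> S"
  shows "rat_polynomial_in S (of_rat c * monomial_value m)"
  unfolding rat_polynomial_in_def
proof (intro exI conjI)
  show "of_rat c * monomial_value m = eval_rat_mpoly (\<lambda>v. v) (Poly_Mapping.single m c)"
    by (subst eval_rat_mpoly_superset[of "{m}"]) auto
  show "\<forall>n\<in>Poly_Mapping.keys (Poly_Mapping.single m c). Poly_Mapping.keys n \<subseteq> S"
    using assms by auto
qed

lemma rat_polynomial_in_of_rat: "rat_polynomial_in S (of_rat c)"
  using rat_polynomial_in_monomial[of 0 S c] by (simp add: monomial_value_def)

lemma rat_polynomial_in_generator:
  assumes "x \<in> S"
  shows "rat_polynomial_in S x"
  using rat_polynomial_in_monomial[of "Poly_Mapping.single x 1" S 1] assms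
  by (simp add: monomial_value_def)

lemma rat_polynomial_in_add:
  assumes "rat_polynomial_in S x" "rat_polynomial_in S y"
  shows "rat_polynomial_in S (x + y)"
proof -
  obtain P Q where P: "x = eval_rat_mpoly (\<lambda>v. v) P" "\<forall>m\<in>Poly_Mapping.keys P. Poly_Mapping.keys m \<subseteq> S"
    and Q: "y = eval_rat_mpoly (\<lambda>v. v) Q" "\<forall>m\<in>Poly_Mapping.keys Q. Poly_Mapping.keys m \<subseteq> S"
    using assms unfolding rat_polynomial_in_def by auto
  let ?M = "Poly_Mapping.keys P \<union> Poly_Mapping.keys Q"
  have keys: "Poly_Mapping.keys (P + Q) \<subseteq> ?M" by (rule Poly_Mapping.keys_add)
  then have "x + y = eval_rat_mpoly (\<lambda>v. v) (P + Q)"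
    using P(1) Q(1)
    by (simp add: eval_rat_mpoly_superset[of ?M] lookup_add of_rat_add sum.distrib ring_distribs)
  with keys P(2) Q(2) show ?thesis
    unfolding rat_polynomial_in_def by blast
qed

lemma rat_polynomial_in_sum:
  assumes "\<And>i. i \<in> I \<Longrightarrow> rat_polynomial_in S (f i)"
  shows "rat_polynomial_in S (\<Sum>i\<in>I. f i)"
  using assms
  \<comment> \<open>Over an infinite index set the sum is 0 by convention, a rational
    constant.\<close>
  by (induction I rule: infinite_finite_induct)
     (use rat_polynomial_in_of_rat[of S 0] in \<open>auto intro: rat_polynomial_in_add\<close>)

text \<open>Expanding into monomials and using closure under sums avoids computing the coefficients
  of the product polynomial.\<close>

lemma rat_polynomial_in_mult:
  assumes "rat_polynomial_in S x" "rat_polynomial_in S y"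
  shows "rat_polynomial_in S (x * y)"
proof -
  obtain P Q where P: "x = eval_rat_mpoly (\<lambda>v. v) P" "\<forall>m\<in>Poly_Mapping.keys P. Poly_Mapping.keys m \<subseteq> S"
    and Q: "y = eval_rat_mpoly (\<lambda>v. v) Q" "\<forall>m\<in>Poly_Mapping.keys Q. Poly_Mapping.keys m \<subseteq> S"
    using assms unfolding rat_polynomial_in_def by auto
  have "x * y = (\<Sum>m\<in>Poly_Mapping.keys P. \<Sum>n\<in>Poly_Mapping.keys Q.
      of_rat (Poly_Mapping.lookup P m * Poly_Mapping.lookup Q n) * monomial_value (m + n))"
    unfolding P(1) Q(1) eval_rat_mpoly_def sum_product monomial_value_add of_rat_mult
    by (simp add: monomial_value_def mult_ac)
  moreover have "Poly_Mapping.keys (m + n) \<subseteq> S"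
    if "m \<in> Poly_Mapping.keys P" "n \<in> Poly_Mapping.keys Q" for m n
    using that P(2) Q(2) Poly_Mapping.keys_add[of m n] by blast
  ultimately show ?thesis
    by (auto intro!: rat_polynomial_in_sum rat_polynomial_in_monomial)
qed

section \<open>Sequences whose limit lies in the ring of generators\<close>

definition tends_into_ring :: "(nat \<Rightarrow> real) \<Rightarrow> bool" where
  "tends_into_ring f \<longleftrightarrow> (\<exists>L. f \<longlonglongrightarrow> L \<and> rat_polynomial_in t_generators L)"

lemma tends_into_ringI:
  "f \<longlonglongrightarrow> L \<Longrightarrow> rat_polynomial_in t_generators L \<Longrightarrow> tends_into_ring f"
  unfolding tends_into_ring_def by blast

lemma tends_into_ring_const_rat:
  "tends_into_ring (\<lambda>_. of_rat c)"
  by (rule tends_into_ringI[OF tendsto_const rat_polynomial_in_of_rat])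

lemma tends_into_ring_const_int:
  "tends_into_ring (\<lambda>_. of_int c)"
  using tends_into_ring_const_rat[of "of_int c"] by simp

lemma tends_into_ring_add:
  "tends_into_ring f \<Longrightarrow> tends_into_ring g \<Longrightarrow> tends_into_ring (\<lambda>N. f N + g N)"
  unfolding tends_into_ring_def by (blast intro: tendsto_add rat_polynomial_in_add)

lemma tends_into_ring_mult:
  "tends_into_ring f \<Longrightarrow> tends_into_ring g \<Longrightarrow> tends_into_ring (\<lambda>N. f N * g N)"
  unfolding tends_into_ring_def by (blast intro: tendsto_mult rat_polynomial_in_mult)

lemma tends_into_ring_diff:
  "tends_into_ring f \<Longrightarrow> tends_into_ring g \<Longrightarrow> tends_into_ring (\<lambda>N. f N - g N)"
  using tends_into_ring_add[of f "\<lambda>N. of_int (-1) * g N"]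
    tends_into_ring_mult[OF tends_into_ring_const_int[of "-1"], of g] by simp

lemma tends_into_ring_sum:
  "(\<And>i. i \<in> I \<Longrightarrow> tends_into_ring (f i)) \<Longrightarrow> tends_into_ring (\<lambda>N. \<Sum>i\<in>I. f i N)"
proof (induction I rule: infinite_finite_induct)
  case (insert i I)
  then show ?case by (simp add: tends_into_ring_add)
qed (use tends_into_ring_const_int[of 0] in simp_all)

text \<open>Convergence of \<open>f\<close> is part of the conclusion; this is how a folded sum
  inherits the limit of its main term.\<close>

lemma tends_into_ring_cong_limit:
  assumes "tends_into_ring g" "(\<lambda>N. f N - g N) \<longlonglongrightarrow> 0"
  shows "tends_into_ring f"
proof -
  obtain L where L: "g \<longlonglongrightarrow> L" "rat_polynomial_in t_generators L"
    using assms(1) unfolding tends_into_ring_def by blast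
  have "f \<longlonglongrightarrow> L"
    using tendsto_add[OF assms(2) L(1)] by simp
  with L(2) show ?thesis by (rule tends_into_ringI[rotated])
qed

subsection \<open>Summation identities\<close>

text \<open>For \<open>s = -1\<close> the limit is \<open>- (2 ^ i)\<close> times the beta value at
  \<open>i\<close>; for \<open>s = 1\<close> and \<open>i \<ge> 2\<close> it is
  \<open>2 ^ i - 1\<close> times the zeta value at \<open>i\<close>.\<close>

definition half_sum :: "real \<Rightarrow> nat \<Rightarrow> nat \<Rightarrow> real" where
  "half_sum s i N = (\<Sum>n=1..N. s ^ n / (real n - 1/2) ^ i)"

definition power_sum :: "real \<Rightarrow> nat \<Rightarrow> nat \<Rightarrow> real" where
  "power_sum s j N = (\<Sum>k=1..N. s ^ k / real k ^ j)"

text \<open>The interval is invariant under the reflection \<open>n \<mapsto> 1 - n\<close>, which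
  negates \<open>n - 1/2\<close>.\<close>

lemma sum_symmetric_interval:
  fixes f :: "int \<Rightarrow> real"
  shows "(\<Sum>n\<in>{1 - int N..int N}. f n) = (\<Sum>n=1..N. f (int n) + f (1 - int n))"
proof (induction N)
  case 0
  then show ?case by simp
next
  case (Suc N)
  have "{1 - int (Suc N)..int (Suc N)} = insert (int (Suc N)) (insert (- int N) {1 - int N..int N})"
    by auto
  with Suc show ?case by simp
qed

text \<open>Induction on the weight by \<open>1 / (x * y) = (1 / x - 1 / y) / (y - x)\<close>, which
  lowers \<open>p\<close> in one summand and \<open>q\<close> in the other. Among the coefficients
  only \<open>d p\<close> is evaluated: for \<open>q = 1\<close> it belongs to the term with
  \<open>y - x\<close> to the first power, whose divergence has to cancel later.\<close>

lemma partial_fractions: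
  assumes "p + q \<ge> 1"
  shows "\<exists>c d :: nat \<Rightarrow> int. d p = (-1) ^ q \<and>
    (\<forall>x y :: real. x \<noteq> 0 \<longrightarrow> y \<noteq> 0 \<longrightarrow> x \<noteq> y \<longrightarrow>
      1 / (y ^ p * x ^ q) = (\<Sum>i=1..q. of_int (c i) / ((y - x) ^ (p + q - i) * x ^ i))
                          + (\<Sum>i=1..p. of_int (d i) / ((y - x) ^ (p + q - i) * y ^ i)))"
  using assms
proof (induction "p + q" arbitrary: p q rule: less_induct)
  case less
  consider "p = 0" "q \<ge> 1" | "q = 0" "p \<ge> 1" | "p \<ge> 1" "q \<ge> 1"
    using less.prems by fastforce
  then show ?case
  proof cases
    case 1
    \<comment> \<open>The second sum is empty here; \<open>d\<close> is chosen only to have the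
      prescribed value at \<open>p\<close>.\<close>
    then show ?thesis
      by (intro exI[of _ "\<lambda>i. if i = q then 1 else 0"] exI[of _ "\<lambda>_. (-1) ^ q"])
         (auto simp: if_distrib[of of_int] if_distrib[of "\<lambda>z. z / _"] cong: if_cong)
  next
    case 2
    then show ?thesis
      by (intro exI[of _ "\<lambda>i. 0"] exI[of _ "\<lambda>i. if i = p then 1 else 0"])
         (auto simp: if_distrib[of of_int] if_distrib[of "\<lambda>z. z / _"] cong: if_cong)
  next
    case 3
    then obtain p' q' where pq: "p = Suc p'" "q = Suc q'"
      by (metis Suc_le_D One_nat_def)
    obtain c1 d1 :: "nat \<Rightarrow> int" where 1: "\<And>x y :: real. x \<noteq> 0 \<Longrightarrow> y \<noteq> 0 \<Longrightarrow> x \<noteq> y \<Longrightarrow>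
        1 / (y ^ p' * x ^ q) = (\<Sum>i=1..q. of_int (c1 i) / ((y - x) ^ (p' + q - i) * x ^ i))
                          + (\<Sum>i=1..p'. of_int (d1 i) / ((y - x) ^ (p' + q - i) * y ^ i))"
      using less.hyps[of p' q] pq by auto
    obtain c2 d2 :: "nat \<Rightarrow> int" where d2: "d2 p = (-1) ^ q'"
      and 2: "\<And>x y :: real. x \<noteq> 0 \<Longrightarrow> y \<noteq> 0 \<Longrightarrow> x \<noteq> y \<Longrightarrow>
        1 / (y ^ p * x ^ q') = (\<Sum>i=1..q'. of_int (c2 i) / ((y - x) ^ (p + q' - i) * x ^ i))
                          + (\<Sum>i=1..p. of_int (d2 i) / ((y - x) ^ (p + q' - i) * y ^ i))"
      using less.hyps[of p q'] pq by auto
    \<comment> \<open>The induction hypotheses say nothing about \<open>c2 q\<close> and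
      \<open>d1 p\<close>, which lie outside their sums, so both are replaced by 0. Thus
      \<open>d p = - d2 p\<close>, and the sign alternates with \<open>q\<close>.\<close>
    define c where "c i = c1 i - (if i = q then 0 else c2 i)" for i
    define d where "d i = (if i = p then 0 else d1 i) - d2 i" for i
    have "1 / (y ^ p * x ^ q) = (\<Sum>i=1..q. of_int (c i) / ((y - x) ^ (p + q - i) * x ^ i))
                          + (\<Sum>i=1..p. of_int (d i) / ((y - x) ^ (p + q - i) * y ^ i))"
      if nz: "x \<noteq> 0" "y \<noteq> 0" "x \<noteq> y" for x y :: real
    proof -
      have yx: "y - x \<noteq> 0" using nz by simp
      have extend_c: "(\<Sum>i=1..q'. of_int (c2 i) / ((y - x) ^ (p + q' - i) * x ^ i))
          = (\<Sum>i=1..q. (if i = q then 0 else of_int (c2 i)) / ((y - x) ^ (p + q' - i) * x ^ i))"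
        by (simp add: pq)
      have extend_d: "(\<Sum>i=1..p'. of_int (d1 i) / ((y - x) ^ (p' + q - i) * y ^ i))
          = (\<Sum>i=1..p. (if i = p then 0 else of_int (d1 i)) / ((y - x) ^ (p' + q - i) * y ^ i))"
        by (simp add: pq)
      have divide_pow: "u / ((y - x) ^ m * z) / (y - x) = u / ((y - x) ^ Suc m * z)" for u m z
        by simp
      have "1 / (y ^ p * x ^ q) = (1 / (y ^ p' * x ^ q) - 1 / (y ^ p * x ^ q')) / (y - x)"
        using nz yx by (simp add: pq field_simps)
      also have "\<dots> = ((\<Sum>i=1..q. of_int (c i) / ((y - x) ^ (p + q' - i) * x ^ i))
                     + (\<Sum>i=1..p. of_int (d i) / ((y - x) ^ (p + q' - i) * y ^ i))) / (y - x)"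
        unfolding 1[OF nz] 2[OF nz] extend_c extend_d
        by (simp add: pq c_def d_def sum_subtractf[symmetric] diff_divide_distrib[symmetric]
              add_diff_add if_distrib[of real_of_int] del: sum.cl_ivl_Suc cong: if_cong)
      also have "\<dots> = (\<Sum>i=1..q. of_int (c i) / ((y - x) ^ Suc (p + q' - i) * x ^ i))
                     + (\<Sum>i=1..p. of_int (d i) / ((y - x) ^ Suc (p + q' - i) * y ^ i))"
        by (simp only: add_divide_distrib sum_divide_distrib divide_pow)
      also have "\<dots> = (\<Sum>i=1..q. of_int (c i) / ((y - x) ^ (p + q - i) * x ^ i))
                     + (\<Sum>i=1..p. of_int (d i) / ((y - x) ^ (p + q - i) * y ^ i))"
      proof -
        \<comment> \<open>The truncated subtraction is exact because \<open>i \<le> p + q'\<close>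
          throughout.\<close>
        have "Suc (p + q' - i) = p + q - i" if "i \<in> {1..q} \<or> i \<in> {1..p}" for i
          using that by (auto simp: pq)
        then show ?thesis by (intro arg_cong2[of _ _ _ _ "(+)"] sum.cong refl) (simp_all only: simp_thms)
      qed
      finally show ?thesis .
    qed
    moreover have "d p = (-1) ^ q" using d2 by (simp add: d_def pq)
    ultimately show ?thesis by blast
  qed
qed

section \<open>Abel summation and alternating sums\<close>

text \<open>This form uses the tails of \<open>a\<close> rather than its initial sums, because in
  the application the tails decay like \<open>1 / l\<close>.\<close>

lemma abel_summation:
  fixes a g :: "nat \<Rightarrow> real"
  shows "(\<Sum>m=1..N. a m * g m) =
    (\<Sum>n=1..N. a n) * g 1 + (\<Sum>l=1..<N. (\<Sum>n=Suc l..N. a n) * (g (Suc l) - g l))"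
proof (induction N)
  case 0
  then show ?case by simp
next
  case (Suc N)
  show ?case
  proof (cases "N = 0")
    case False
    have tele: "(\<Sum>l=1..<N. g (Suc l) - g l) = g N - g 1"
      using False by (intro sum_Suc_diff') simp
    have "(\<Sum>l=1..<Suc N. (\<Sum>n=Suc l..Suc N. a n) * (g (Suc l) - g l))
      = (\<Sum>l=1..<N. (\<Sum>n=Suc l..N. a n) * (g (Suc l) - g l) + a (Suc N) * (g (Suc l) - g l))
        + a (Suc N) * (g (Suc N) - g N)"
      using False by (simp add: distrib_right)
    also have "\<dots> = (\<Sum>l=1..<N. (\<Sum>n=Suc l..N. a n) * (g (Suc l) - g l))
        + a (Suc N) * (g (Suc N) - g 1)"
      unfolding sum.distrib sum_distrib_left[symmetric] tele by (simp add: algebra_simps)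
    finally show ?thesis using Suc by (simp add: algebra_simps)
  qed simp
qed

lemma alternating_sum_bound:
  fixes f :: "nat \<Rightarrow> real"
  assumes "\<And>n. m \<le> n \<Longrightarrow> f (Suc n) \<le> f n" "\<And>n. m \<le> n \<Longrightarrow> 0 \<le> f n"
  shows "\<bar>\<Sum>n=m..M. (-1) ^ n * f n\<bar> \<le> f m"
proof -
  \<comment> \<open>The strengthened claim also fixes the sign: the sum lies between 0 and its first
    term. Splitting off that term leaves \<open>f m\<close> minus a number between 0 and
    \<open>f (Suc m)\<close>.\<close>
  have "0 \<le> (-1) ^ m * (\<Sum>n=m..M. (-1) ^ n * f n) \<and> (-1) ^ m * (\<Sum>n=m..M. (-1) ^ n * f n) \<le> f m"
    using assms
  proof (induction "Suc M - m" arbitrary: m)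
    case 0
    then show ?case by simp
  next
    case (Suc d)
    have "m \<le> M" using Suc.hyps(2) by simp
    then have split: "(\<Sum>n=m..M. (-1) ^ n * f n) = (-1) ^ m * f m + (\<Sum>n=Suc m..M. (-1) ^ n * f n)"
      by (rule sum.atLeast_Suc_atMost)
    have sq: "(-1) ^ m * ((-1) ^ m * z) = z" for z :: real
      by (simp flip: mult.assoc power_mult_distrib)
    have "0 \<le> (-1) ^ Suc m * (\<Sum>n=Suc m..M. (-1) ^ n * f n) \<and>
          (-1) ^ Suc m * (\<Sum>n=Suc m..M. (-1) ^ n * f n) \<le> f (Suc m)"
      using Suc.hyps(2) Suc.prems by (intro Suc.hyps(1)) auto
    with Suc.prems(1)[of m] show ?case
      unfolding split by (simp add: ring_distribs sq)
  qed
  then show ?thesis by (cases "even m") auto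
qed

subsection \<open>Symmetric summation over half-integers\<close>

text \<open>The integer power \<open>powi\<close> gives a meaning to the sign at negative
  indices.\<close>

definition half_term :: "real \<Rightarrow> nat \<Rightarrow> int \<Rightarrow> real" where
  "half_term s i n = s powi n / (of_int n - 1/2) ^ i"

lemma half_term_of_nat: "half_term s i (int n) = s ^ n / (real n - 1/2) ^ i"
  by (simp add: half_term_def)

lemma half_int_nonzero: "of_int n - 1/2 \<noteq> (0 :: real)"
proof
  assume "of_int n - 1/2 = (0 :: real)"
  then have "of_int (2 * n) = (of_int 1 :: real)" by simp
  then have "2 * n = 1" by (simp only: of_int_eq_iff)
  then show False by presburger
qed

lemma sign_power_int_minus:
  fixes s :: real
  assumes "s = 1 \<or> s = -1"
  shows "s powi (- n) = s powi n"
proof -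
  have "inverse s = s" using assms by auto
  then show ?thesis by (metis power_int_inverse power_int_minus)
qed

text \<open>The half-integer changes sign, giving \<open>(-1) ^ i\<close>, and
  \<open>s powi (1 - n) = s * s powi n\<close> because a sign is its own inverse.\<close>

lemma half_term_reflect:
  assumes "s = 1 \<or> s = -1"
  shows "half_term s i (1 - n) = s * (-1) ^ i * half_term s i n"
proof -
  have "of_int (1 - n) - 1/2 = - 1 * (of_int n - 1/2 :: real)" by simp
  then have "(of_int (1 - n) - 1/2) ^ i = ((-1) ^ i * (of_int n - 1/2) ^ i :: real)"
    by (simp only: power_mult_distrib)
  moreover have "s powi (1 - n) = s * s powi n"
    using assms power_int_add[of s 1 "-n"] sign_power_int_minus[OF assms, of n] by auto
  moreover have "1 / (-1) ^ i = ((-1) ^ i :: real)" by (cases "even i") auto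
  ultimately show ?thesis
    unfolding half_term_def by (metis (no_types, lifting) divide_divide_eq_left mult.assoc
      mult.commute mult.right_neutral times_divide_eq_right)
qed

section \<open>Double, bilateral and folded sums\<close>

definition double_sum :: "nat \<Rightarrow> nat \<Rightarrow> real \<Rightarrow> real \<Rightarrow> nat \<Rightarrow> real" where
  "double_sum p q s1 s2 N = (\<Sum>n=1..N. \<Sum>m=1..<n. s1 ^ n * s2 ^ m / ((real n - 1/2) ^ p * (real m - 1/2) ^ q))"

definition bilateral_sum :: "nat \<Rightarrow> nat \<Rightarrow> real \<Rightarrow> real \<Rightarrow> nat \<Rightarrow> real" where
  "bilateral_sum p q s1 s2 N = (\<Sum>n\<in>{1 - int N..int N}. \<Sum>m\<in>{1 - int N..int N}.
     if m < n then half_term s1 p n * half_term s2 q m else 0)"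

text \<open>This is what one partial-fraction term of the bilateral sum becomes. For a fixed lower
  index \<open>m\<close> the difference \<open>k = n - m\<close> runs up to \<open>N - m\<close>;
  for the reflected index \<open>1 - m\<close> it runs up to \<open>N + m - 1\<close>, and the
  factor \<open>r * (-1) ^ i\<close> comes from the reflection.\<close>

definition folded_sum :: "real \<Rightarrow> nat \<Rightarrow> real \<Rightarrow> nat \<Rightarrow> nat \<Rightarrow> real" where
  "folded_sum r i s j N = (\<Sum>m=1..N. r ^ m / (real m - 1/2) ^ i *
     (power_sum s j (N - m) + r * (-1) ^ i * power_sum s j (N + m - 1)))"

lemma double_sum_if:
  "double_sum p q s1 s2 N = (\<Sum>n=1..N. \<Sum>m=1..N.
     if m < n then half_term s1 p (int n) * half_term s2 q (int m) else 0)"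
proof -
  have "(\<Sum>m=1..N. if m < n then half_term s1 p (int n) * half_term s2 q (int m) else 0) =
     (\<Sum>m=1..<n. s1 ^ n * s2 ^ m / ((real n - 1/2) ^ p * (real m - 1/2) ^ q))"
    if "n \<in> {1..N}" for n
    using that by (intro sum.mono_neutral_cong_right) (auto simp: half_term_of_nat)
  then show ?thesis by (simp add: double_sum_def)
qed

lemma double_sum_if_swap:
  "double_sum q p s2 s1 N = (\<Sum>n=1..N. \<Sum>m=1..N.
     if n < m then half_term s1 p (int n) * half_term s2 q (int m) else 0)"
  unfolding double_sum_if by (subst sum.swap) (simp add: mult.commute cong: if_cong)

lemma half_sum_conv: "half_sum s i N = (\<Sum>n=1..N. half_term s i (int n))"
  by (simp add: half_sum_def half_term_of_nat)

text \<open>The square of index pairs splits into the regions \<open>m < n\<close>,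
  \<open>n < m\<close> and \<open>n = m\<close>.\<close>

lemma stuffle_product:
  "double_sum p q s1 s2 N + double_sum q p s2 s1 N + half_sum (s1 * s2) (p + q) N
     = half_sum s1 p N * half_sum s2 q N"
proof -
  have "half_sum (s1 * s2) (p + q) N
      = (\<Sum>n=1..N. half_term s1 p (int n) * half_term s2 q (int n))"
    by (simp add: half_sum_def half_term_of_nat power_add power_mult_distrib)
  also have "\<dots> = (\<Sum>n=1..N. \<Sum>m=1..N. if n = m then half_term s1 p (int n) * half_term s2 q (int m) else 0)"
    by (intro sum.cong refl) (simp add: sum.delta)
  finally have diag: "half_sum (s1 * s2) (p + q) N = \<dots>" .
  show ?thesis
    unfolding double_sum_if[of p q] double_sum_if_swap[of q p] half_sum_conv[of s1] half_sum_conv[of s2]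
      sum_product diag sum.distrib[symmetric]
    by (intro sum.cong refl) auto
qed

text \<open>The index square is cut into quadrants by reflecting nonpositive indices. If both
  indices are reflected, their order reverses and the double sum with exchanged arguments appears.
  If only \<open>m\<close> is reflected, \<open>m < n\<close> always holds and the full product
  appears; if only \<open>n\<close> is, it never holds.\<close>

lemma bilateral_sum_by_sign:
  assumes s1: "s1 = 1 \<or> s1 = -1" and s2: "s2 = 1 \<or> s2 = -1"
  shows "bilateral_sum p q s1 s2 N = double_sum p q s1 s2 N
    + s1 * s2 * (-1) ^ (p + q) * double_sum q p s2 s1 N
    + s2 * (-1) ^ q * (half_sum s1 p N * half_sum s2 q N)"
proof -
  have "bilateral_sum p q s1 s2 N = (\<Sum>n=1..N. \<Sum>m=1..N.
      ((if m < n then half_term s1 p (int n) * half_term s2 q (int m) else 0)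
       + s1 * s2 * (-1) ^ (p + q) *
         (if n < m then half_term s1 p (int n) * half_term s2 q (int m) else 0))
       + s2 * (-1) ^ q * (half_term s1 p (int n) * half_term s2 q (int m)))"
    unfolding bilateral_sum_def sum_symmetric_interval sum.distrib[symmetric]
    by (intro sum.cong refl)
       (auto simp: half_term_reflect[OF s1] half_term_reflect[OF s2] power_add algebra_simps)
  then show ?thesis
    unfolding double_sum_if[of p q] double_sum_if_swap[of q p] half_sum_conv sum_product
    by (simp only: sum.distrib sum_distrib_left)
qed

lemma sum_below_eq_power_sum:
  assumes "n \<in> {1 - int N..int N}"
  shows "(\<Sum>m\<in>{1 - int N..int N}. if m < n then s ^ nat (n - m) / of_int (n - m) ^ j else 0)
     = power_sum s j (nat (n + int N - 1))"
proof -
  have "(\<Sum>m\<in>{1 - int N..int N}. if m < n then s ^ nat (n - m) / of_int (n - m) ^ j else 0)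
     = (\<Sum>m\<in>{1 - int N..n - 1}. s ^ nat (n - m) / of_int (n - m) ^ j)"
    using assms by (intro sum.mono_neutral_cong_right) auto
  also have "\<dots> = power_sum s j (nat (n + int N - 1))"
    unfolding power_sum_def
    by (rule sum.reindex_bij_witness[of _ "\<lambda>k. n - int k" "\<lambda>m. nat (n - m)"]) auto
  finally show ?thesis .
qed

lemma sum_above_eq_power_sum:
  assumes "m \<in> {1 - int N..int N}"
  shows "(\<Sum>n\<in>{1 - int N..int N}. if m < n then s ^ nat (n - m) / of_int (n - m) ^ j else 0)
     = power_sum s j (nat (int N - m))"
proof -
  have "(\<Sum>n\<in>{1 - int N..int N}. if m < n then s ^ nat (n - m) / of_int (n - m) ^ j else 0)
     = (\<Sum>n\<in>{m + 1..int N}. s ^ nat (n - m) / of_int (n - m) ^ j)"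
    using assms by (intro sum.mono_neutral_cong_right) auto
  also have "\<dots> = power_sum s j (nat (int N - m))"
    unfolding power_sum_def
    by (rule sum.reindex_bij_witness[of _ "\<lambda>k. m + int k" "\<lambda>n. nat (n - m)"]) auto
  finally show ?thesis .
qed

lemma folded_sum_above:
  assumes "r = 1 \<or> r = -1"
  shows "(\<Sum>m\<in>{1 - int N..int N}. half_term r i m * power_sum s j (nat (int N - m))) = folded_sum r i s j N"
proof -
  have "nat (int N - int m) = N - m" "nat (int N - (1 - int m)) = N + m - 1" if "m \<in> {1..N}" for m
    using that by auto
  then show ?thesis
    unfolding sum_symmetric_interval folded_sum_def
    by (intro sum.cong refl)
       (simp add: half_term_reflect[OF assms] half_term_of_nat algebra_simps)
qed

text \<open>The reflection exchanges the cut-offs \<open>N - m\<close> and \<open>N + m - 1\<close>,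
  so the same folded sum arises up to the sign \<open>r * (-1) ^ i\<close>, whose square is
  1.\<close>

lemma folded_sum_below:
  assumes "r = 1 \<or> r = -1"
  shows "(\<Sum>n\<in>{1 - int N..int N}. half_term r i n * power_sum s j (nat (n + int N - 1)))
    = r * (-1) ^ i * folded_sum r i s j N"
proof -
  have "nat (int m + int N - 1) = N + m - 1" "nat (1 - int m + int N - 1) = N - m" if "m \<in> {1..N}" for m
    using that by auto
  moreover have "r * (-1) ^ i * (r * (-1) ^ i * z) = z" for z
    using assms by (auto simp flip: mult.assoc power_mult_distrib)
  ultimately show ?thesis
    unfolding sum_symmetric_interval folded_sum_def sum_distrib_left
    by (intro sum.cong refl)
       (simp add: half_term_reflect[OF assms] half_term_of_nat algebra_simps)
qed

text \<open>The signs separate in two ways: with \<open>r = s1 * s2\<close> and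
  \<open>k = n - m\<close>, the factor \<open>s1 powi n * s2 powi m\<close> equals both
  \<open>r powi m * s1 ^ k\<close> and \<open>r powi n * s2 ^ k\<close>. The first suits the
  fractions in \<open>m\<close>, the second those in \<open>n\<close>.\<close>

lemma bilateral_sum_partial_fractions:
  assumes s1: "s1 = 1 \<or> s1 = -1" and s2: "s2 = 1 \<or> s2 = -1" and pq: "p + q \<ge> 1"
  obtains c d :: "nat \<Rightarrow> int" where "d p = (-1) ^ q"
    "\<And>N. bilateral_sum p q s1 s2 N =
        (\<Sum>i=1..q. of_int (c i) * folded_sum (s1 * s2) i s1 (p + q - i) N)
      + (\<Sum>i=1..p. of_int (d i) * (s1 * s2 * (-1) ^ i * folded_sum (s1 * s2) i s2 (p + q - i) N))"
proof -
  define r where "r = s1 * s2"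
  have r: "r = 1 \<or> r = -1" using s1 s2 by (auto simp: r_def)
  obtain c d :: "nat \<Rightarrow> int" where d: "d p = (-1) ^ q"
    and pf: "\<And>x y :: real. x \<noteq> 0 \<Longrightarrow> y \<noteq> 0 \<Longrightarrow> x \<noteq> y \<Longrightarrow>
      1 / (y ^ p * x ^ q) = (\<Sum>i=1..q. of_int (c i) / ((y - x) ^ (p + q - i) * x ^ i))
                          + (\<Sum>i=1..p. of_int (d i) / ((y - x) ^ (p + q - i) * y ^ i))"
    using partial_fractions[OF pq] by blast
  have "bilateral_sum p q s1 s2 N =
        (\<Sum>i=1..q. of_int (c i) * folded_sum r i s1 (p + q - i) N)
      + (\<Sum>i=1..p. of_int (d i) * (r * (-1) ^ i * folded_sum r i s2 (p + q - i) N))" for N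
  proof -
    let ?I = "{1 - int N..int N}"
    define above where "above i m n =
      (if m < n then s1 ^ nat (n - m) / of_int (n - m) ^ (p + q - i) else 0)" for i and m n :: int
    define below where "below i m n =
      (if m < n then s2 ^ nat (n - m) / of_int (n - m) ^ (p + q - i) else 0)" for i and m n :: int
    have "(if m < n then half_term s1 p n * half_term s2 q m else 0) =
        (\<Sum>i=1..q. of_int (c i) * (half_term r i m * above i m n))
      + (\<Sum>i=1..p. of_int (d i) * (half_term r i n * below i m n))" for m n
    proof (cases "m < n")
      case True
      let ?x = "of_int m - 1/2 :: real" and ?y = "of_int n - 1/2 :: real"
      have nm: "s powi int (nat (n - m)) = s powi (n - m)" for s :: real using True by simp
      have nz: "s1 \<noteq> 0" "s2 \<noteq> 0" using s1 s2 by auto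
      have sign1: "s1 powi n * s2 powi m = r powi m * s1 ^ nat (n - m)"
        unfolding power_int_of_nat[symmetric] nm using nz
        by (simp add: r_def power_int_mult_distrib power_int_diff)
      have "s2 powi (n - m) = s2 powi (m - n)" using sign_power_int_minus[OF s2, of "m - n"] by simp
      then have sign2: "s1 powi n * s2 powi m = r powi n * s2 ^ nat (n - m)"
        unfolding power_int_of_nat[symmetric] nm using nz
        by (simp add: r_def power_int_mult_distrib power_int_diff)
      have "half_term s1 p n * half_term s2 q m = (s1 powi n * s2 powi m) * (1 / (?y ^ p * ?x ^ q))"
        by (simp add: half_term_def)
      also have "1 / (?y ^ p * ?x ^ q) = (\<Sum>i=1..q. of_int (c i) / (of_int (n - m) ^ (p + q - i) * ?x ^ i))
                          + (\<Sum>i=1..p. of_int (d i) / (of_int (n - m) ^ (p + q - i) * ?y ^ i))"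
        using pf[of ?x ?y] half_int_nonzero True by simp
      also have "(s1 powi n * s2 powi m) * \<dots> =
          (\<Sum>i=1..q. (s1 powi n * s2 powi m) * (of_int (c i) / (of_int (n - m) ^ (p + q - i) * ?x ^ i)))
        + (\<Sum>i=1..p. (s1 powi n * s2 powi m) * (of_int (d i) / (of_int (n - m) ^ (p + q - i) * ?y ^ i)))"
        by (simp add: ring_distribs sum_distrib_left)
      also have "\<dots> = (\<Sum>i=1..q. of_int (c i) * (half_term r i m * above i m n))
      + (\<Sum>i=1..p. of_int (d i) * (half_term r i n * below i m n))"
      proof (intro arg_cong2[of _ _ _ _ "(+)"] sum.cong refl)
        show "(s1 powi n * s2 powi m) * (of_int (c i) / (of_int (n - m) ^ (p + q - i) * ?x ^ i))
            = of_int (c i) * (half_term r i m * above i m n)" for i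
          unfolding sign1 by (simp add: above_def half_term_def True mult_ac)
        show "(s1 powi n * s2 powi m) * (of_int (d i) / (of_int (n - m) ^ (p + q - i) * ?y ^ i))
            = of_int (d i) * (half_term r i n * below i m n)" for i
          unfolding sign2 by (simp add: below_def half_term_def True mult_ac)
      qed
      finally show ?thesis using True by simp
    qed (simp add: above_def below_def)
    then have "bilateral_sum p q s1 s2 N =
        (\<Sum>n\<in>?I. \<Sum>m\<in>?I. \<Sum>i=1..q. of_int (c i) * (half_term r i m * above i m n))
      + (\<Sum>n\<in>?I. \<Sum>m\<in>?I. \<Sum>i=1..p. of_int (d i) * (half_term r i n * below i m n))"
      unfolding bilateral_sum_def by (simp only: sum.distrib)
    \<comment> \<open>The index missing from the half-integer factor is moved innermost, where it
      sums to a power sum in \<open>k\<close>.\<close>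
    also have "(\<Sum>n\<in>?I. \<Sum>m\<in>?I. \<Sum>i=1..q. of_int (c i) * (half_term r i m * above i m n))
      = (\<Sum>i=1..q. of_int (c i) * (\<Sum>m\<in>?I. half_term r i m * (\<Sum>n\<in>?I. above i m n)))"
      unfolding sum_distrib_left
      by (subst sum.swap, subst sum.swap[of _ "{1..q}"], subst (2) sum.swap, rule refl)
    also have "\<dots> = (\<Sum>i=1..q. of_int (c i) * folded_sum r i s1 (p + q - i) N)"
    proof -
      have "(\<Sum>n\<in>?I. above i m n) = power_sum s1 (p + q - i) (nat (int N - m))" if "m \<in> ?I" for i m
        unfolding above_def by (rule sum_above_eq_power_sum[OF that])
      then show ?thesis by (simp add: folded_sum_above[OF r, symmetric])
    qed
    also have "(\<Sum>n\<in>?I. \<Sum>m\<in>?I. \<Sum>i=1..p. of_int (d i) * (half_term r i n * below i m n))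
      = (\<Sum>i=1..p. of_int (d i) * (\<Sum>n\<in>?I. half_term r i n * (\<Sum>m\<in>?I. below i m n)))"
      unfolding sum_distrib_left
      by (subst (2) sum.swap, subst sum.swap, rule refl)
    also have "\<dots> = (\<Sum>i=1..p. of_int (d i) * (r * (-1) ^ i * folded_sum r i s2 (p + q - i) N))"
    proof -
      have "(\<Sum>m\<in>?I. below i m n) = power_sum s2 (p + q - i) (nat (n + int N - 1))" if "n \<in> ?I" for i n
        unfolding below_def by (rule sum_below_eq_power_sum[OF that])
      then show ?thesis by (simp add: folded_sum_below[OF r, symmetric])
    qed
    finally show ?thesis .
  qed
  with d show ?thesis using that unfolding r_def by blast
qed

subsection \<open>Asymptotics of the folded sums\<close>

text \<open>The errors below are bounded by multiples of this ratio and of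
  \<open>1 / N\<close>.\<close>

lemma harm_over_n_tendsto_0: "(\<lambda>N. (harm N :: real) / real N) \<longlonglongrightarrow> 0"
proof -
  have "(\<lambda>N. (harm N - ln (real N)) * (1 / real N) + ln (real N) / real N) \<longlonglongrightarrow> euler_mascheroni * 0 + 0"
    by (intro tendsto_add tendsto_mult euler_mascheroni_LIMSEQ lim_1_over_n lim_ln_over_n)
  then show ?thesis by (simp add: algebra_simps diff_divide_distrib)
qed

text \<open>Since \<open>2 * y \<ge> 1\<close>, lowering the exponent costs at most a power of
  2.\<close>

lemma shifted_pow_le:
  fixes y :: real
  assumes "y \<ge> 1/2" "k \<le> i"
  shows "1 / y ^ i \<le> 2 ^ i / y ^ k"
proof -
  have "y ^ k \<le> 2 ^ i * y ^ i"
  proof -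
    have "1 \<le> (2 * y) ^ (i - k)" using assms by (intro one_le_power) simp
    then have "y ^ k * 1 \<le> y ^ k * (2 * y) ^ (i - k)" using assms by (intro mult_left_mono) auto
    also have "\<dots> = 2 ^ (i - k) * y ^ i"
      using assms by (simp add: power_mult_distrib flip: power_add)
    also have "\<dots> \<le> 2 ^ i * y ^ i" using assms by (intro mult_right_mono power_increasing) auto
    finally show ?thesis by simp
  qed
  then show ?thesis using assms by (simp add: field_simps)
qed

text \<open>For \<open>s = 1\<close> the terms are compared with a telescoping series; for
  \<open>s = -1\<close> the alternating bound applies. The shift \<open>c = 0\<close> serves power
  sums and \<open>c = 1/2\<close> half-integer sums.\<close>

lemma tail_bound:
  fixes c :: real
  assumes s: "s = 1 \<or> s = -1" and i: "i \<ge> 1" "(i, s) \<noteq> (1, 1)" and c: "c \<le> 1/2" and m: "m \<ge> 1"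
  shows "\<bar>\<Sum>n=m..M. s ^ n / (real n - c) ^ i\<bar> \<le> 3 * 2 ^ i / (real m - c)"
proof (cases "s = 1")
  case True
  with i have i2: "2 \<le> i" by (cases "i = 1") auto
  have "\<bar>\<Sum>n=m..M. s ^ n / (real n - c) ^ i\<bar> = (\<Sum>n=m..M. 1 / (real n - c) ^ i)"
  proof -
    have "0 \<le> (\<Sum>n=m..M. 1 / (real n - c) ^ i)" using c m by (intro sum_nonneg) auto
    then show ?thesis using True by simp
  qed
  also have "\<dots> \<le> (\<Sum>n=m..M. 3 * 2 ^ i * (1 / (real n - c) - 1 / (real (Suc n) - c)))"
  proof (rule sum_mono)
    fix n assume "n \<in> {m..M}"
    then have y: "real n - c \<ge> 1/2" using m c by simp
    define y where "y = real n - c"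
    have "1 / y ^ i \<le> 2 ^ i / y ^ 2"
      using y i2 by (intro shifted_pow_le) (auto simp: y_def)
    also have "\<dots> \<le> 3 * 2 ^ i * (1 / y - 1 / (y + 1))"
    proof -
      \<comment> \<open>The constant 3 comes from \<open>y + 1 \<le> 3 * y\<close>, valid for
        \<open>y \<ge> 1/2\<close>.\<close>
      have "1 / y ^ 2 \<le> 3 / (y * (y + 1))"
      proof -
        have "1 / y ^ 2 = 3 / (y * (3 * y))" by (simp add: power2_eq_square)
        also have "\<dots> \<le> 3 / (y * (y + 1))"
          using y by (intro divide_left_mono mult_left_mono) (auto simp: y_def)
        finally show ?thesis .
      qed
      also have "3 / (y * (y + 1)) = 3 * (1 / y - 1 / (y + 1))"
        using y by (simp add: y_def[symmetric] field_simps)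
      finally have "2 ^ i * (1 / y ^ 2) \<le> 2 ^ i * (3 * (1 / y - 1 / (y + 1)))"
        by (intro mult_left_mono) auto
      then show ?thesis by (simp add: algebra_simps)
    qed
    finally show "1 / (real n - c) ^ i \<le> 3 * 2 ^ i * (1 / (real n - c) - 1 / (real (Suc n) - c))"
      by (simp add: y_def algebra_simps)
  qed
  also have "\<dots> = 3 * 2 ^ i * (\<Sum>n=m..M. (- 1 / (real (Suc n) - c)) - (- 1 / (real n - c)))"
    unfolding sum_distrib_left by (intro sum.cong refl) simp
  also have "\<dots> \<le> 3 * 2 ^ i * (1 / (real m - c))"
  proof (cases "m \<le> M")
    case True
    then have "(\<Sum>n=m..M. (- 1 / (real (Suc n) - c)) - (- 1 / (real n - c)))
      = - 1 / (real (Suc M) - c) - (- 1 / (real m - c))"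
      by (intro sum_Suc_diff) simp
    then show ?thesis using c by (intro mult_left_mono) auto
  qed (use m c in simp)
  finally show ?thesis by simp
next
  case False
  with s have [simp]: "s = -1" by simp
  have "\<bar>\<Sum>n=m..M. s ^ n / (real n - c) ^ i\<bar> = \<bar>\<Sum>n=m..M. (-1) ^ n * (1 / (real n - c) ^ i)\<bar>"
    by simp
  also have "\<dots> \<le> 1 / (real m - c) ^ i"
    using m c by (intro alternating_sum_bound) (auto intro!: divide_left_mono power_mono)
  also have "\<dots> \<le> 2 ^ i / (real m - c) ^ 1"
    using m c i by (intro shifted_pow_le) auto
  also have "\<dots> \<le> 3 * 2 ^ i / (real m - c)"
    using m c by (simp add: divide_right_mono)
  finally show ?thesis by simp
qed

lemma power_sum_diff:
  assumes "a \<le> b"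
  shows "power_sum s j b - power_sum s j a = (\<Sum>k=Suc a..b. s ^ k / real k ^ j)"
proof -
  have "power_sum s j b = power_sum s j a + (\<Sum>k=Suc a..b. s ^ k / real k ^ j)"
    unfolding power_sum_def using assms sum.ub_add_nat[of 1 a _ "b - a"] by simp
  then show ?thesis by simp
qed

lemma sum_inverse_reflect:
  "(\<Sum>m=1..N. 1 / real (N + 1 - m)) = harm N"
  unfolding harm_def inverse_eq_divide of_nat_diff
  by (rule sum.reindex_bij_witness[of _ "\<lambda>m. N + 1 - m" "\<lambda>m. N + 1 - m"]) auto

text \<open>The sign -1 turns the bracket into a difference of power sums, which is of order
  \<open>1 / (N + 1 - m)\<close> by the tail bound, while the weight is of order
  \<open>1 / m\<close>. Partial fractions of the product leave a multiple of
  \<open>harm N / N\<close>.\<close>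

lemma folded_sum_wrong_parity:
  assumes r: "r = 1 \<or> r = -1" and s: "s = 1 \<or> s = -1" and i: "i \<ge> 1"
    and parity: "r * (-1) ^ i = -1" and j: "j \<ge> 1" "(j, s) \<noteq> (1, 1)"
  shows "folded_sum r i s j \<longlonglongrightarrow> 0"
proof (rule Lim_null_comparison)
  \<comment> \<open>The factor \<open>3 * 2 ^ j\<close> is from the tail bound;
    \<open>2 ^ i * 2\<close> is from replacing \<open>(m - 1/2) ^ i\<close> by
    \<open>m\<close>.\<close>
  let ?K = "3 * 2 ^ j * 2 ^ i * 2 :: real"
  show "(\<lambda>N. ?K * 2 * (harm N / real N)) \<longlonglongrightarrow> 0"
    using tendsto_mult_right_zero[OF harm_over_n_tendsto_0] .
  show "\<forall>\<^sub>F N in sequentially. norm (folded_sum r i s j N) \<le> ?K * 2 * (harm N / real N)"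
  proof (intro eventually_sequentiallyI[of 1])
    fix N :: nat assume N: "N \<ge> 1"
    have "norm (folded_sum r i s j N) \<le>
        (\<Sum>m=1..N. norm (r ^ m / (real m - 1/2) ^ i * (power_sum s j (N - m) - power_sum s j (N + m - 1))))"
      unfolding folded_sum_def parity by (rule order_trans[OF norm_sum]) simp
    also have "\<dots> \<le> (\<Sum>m=1..N. ?K / real N * (1 / real m + 1 / real (N + 1 - m)))"
    proof (rule sum_mono)
      fix m assume m: "m \<in> {1..N}"
      have "\<bar>power_sum s j (N - m) - power_sum s j (N + m - 1)\<bar>
          = \<bar>\<Sum>k=Suc (N - m)..N + m - 1. s ^ k / (real k - 0) ^ j\<bar>"
      proof -
        have "N - m \<le> N + m - 1" using m by auto
        from power_sum_diff[OF this, of s j] show ?thesis by (simp add: abs_minus_commute[of "power_sum s j (N - m)"])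
      qed
      also have "\<dots> \<le> 3 * 2 ^ j / (real (Suc (N - m)) - 0)"
        using s j by (intro tail_bound) auto
      also have "\<dots> = 3 * 2 ^ j / real (N + 1 - m)" using m by (simp add: Suc_diff_le)
      finally have 1: "\<bar>power_sum s j (N - m) - power_sum s j (N + m - 1)\<bar> \<le> 3 * 2 ^ j / real (N + 1 - m)" .
      have "\<bar>r ^ m / (real m - 1/2) ^ i\<bar> = 1 / (real m - 1/2) ^ i"
        using r m by (auto simp: power_abs abs_mult)
      also have "\<dots> \<le> 2 ^ i / (real m - 1/2) ^ 1"
        using m i by (intro shifted_pow_le) auto
      also have "\<dots> \<le> 2 ^ i * 2 / real m"
        using m by (simp add: field_simps)
      finally have "norm (r ^ m / (real m - 1/2) ^ i * (power_sum s j (N - m) - power_sum s j (N + m - 1)))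
          \<le> 2 ^ i * 2 / real m * (3 * 2 ^ j / real (N + 1 - m))"
        using 1 unfolding real_norm_def abs_mult by (intro mult_mono) auto
      also have "\<dots> = ?K * (1 / (real m * real (N + 1 - m)))" by simp
      also have "1 / (real m * real (N + 1 - m)) = 1 / real (N + 1) * (1 / real m + 1 / real (N + 1 - m))"
        using m by (auto simp: field_simps of_nat_diff)
      also have "\<dots> \<le> 1 / real N * (1 / real m + 1 / real (N + 1 - m))"
        using N by (intro mult_right_mono divide_left_mono) auto
      finally show "norm (r ^ m / (real m - 1/2) ^ i * (power_sum s j (N - m) - power_sum s j (N + m - 1)))
          \<le> ?K / real N * (1 / real m + 1 / real (N + 1 - m))"
        by simp
    qed
    also have "\<dots> = ?K / real N * ((\<Sum>m=1..N. 1 / real m) + (\<Sum>m=1..N. 1 / real (N + 1 - m)))"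
      unfolding sum_distrib_left[symmetric] sum.distrib ..
    also have "\<dots> = ?K * 2 * (harm N / real N)"
      unfolding sum_inverse_reflect by (simp add: harm_def inverse_eq_divide)
    finally show "norm (folded_sum r i s j N) \<le> ?K * 2 * (harm N / real N)" .
  qed
qed

text \<open>On the unit interval the \<open>j\<close>-th power has Lipschitz constant
  \<open>j\<close>.\<close>

lemma power_diff_le:
  fixes u v :: real
  assumes "0 \<le> v" "v \<le> u" "u \<le> 1"
  shows "u ^ j - v ^ j \<le> real j * (u - v)"
proof (induction j)
  case (Suc j)
  have "u ^ Suc j - v ^ Suc j = u * (u ^ j - v ^ j) + v ^ j * (u - v)"
    by (simp add: algebra_simps)
  also have "\<dots> \<le> 1 * (u ^ j - v ^ j) + 1 * (u - v)"
    using assms by (intro add_mono mult_right_mono) (auto intro: power_mono power_le_one)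
  also have "\<dots> \<le> real (Suc j) * (u - v)"
    using Suc by (simp add: algebra_simps)
  finally show ?case .
qed simp

text \<open>Replacing both inner cut-offs by \<open>N\<close> leaves a correction \<open>g m\<close>
  that need not be small for \<open>m\<close> near \<open>N\<close>. Abel summation passes to its
  increments, of order \<open>l / (N * (N - l))\<close>, against tails of order
  \<open>1 / l\<close>. The estimate also covers the divergent case \<open>j = 1\<close>,
  \<open>s = 1\<close>.\<close>

lemma folded_sum_right_parity:
  assumes r: "r = 1 \<or> r = -1" and s: "s = 1 \<or> s = -1" and i: "i \<ge> 1"
    and parity: "r * (-1) ^ i = 1" and j: "j \<ge> 1"
  shows "(\<lambda>N. folded_sum r i s j N - 2 * power_sum s j N * half_sum r i N) \<longlonglongrightarrow> 0"
proof (rule Lim_null_comparison)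
  let ?K = "3 * 2 ^ i :: real"
  \<comment> \<open>For \<open>i = r = 1\<close> the sign would be -1.\<close>
  have ir: "(i, r) \<noteq> (1, 1)" using parity by auto
  define a where "a m = r ^ m / (real m - 1/2) ^ i" for m
  have tail: "\<bar>\<Sum>n=m..N. a n\<bar> \<le> ?K / (real m - 1/2)" if "m \<ge> 1" for m N
    unfolding a_def using tail_bound[OF r i ir _ that, of "1/2" N] by simp
  show "(\<lambda>N. ?K * 2 * (1 / real N) + ?K * 2 * real j * (harm N / real N)) \<longlonglongrightarrow> 0"
    by (rule tendsto_eq_intros tendsto_mult_right_zero harm_over_n_tendsto_0 lim_1_over_n | simp)+
  show "\<forall>\<^sub>F N in sequentially. norm (folded_sum r i s j N - 2 * power_sum s j N * half_sum r i N)
      \<le> ?K * 2 * (1 / real N) + ?K * 2 * real j * (harm N / real N)"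
  proof (intro eventually_sequentiallyI[of 1])
    fix N :: nat assume N: "N \<ge> 1"
    define g where "g m = power_sum s j (N - m) + power_sum s j (N + m - 1) - 2 * power_sum s j N" for m
    have "folded_sum r i s j N - 2 * power_sum s j N * half_sum r i N = (\<Sum>m=1..N. a m * g m)"
      unfolding folded_sum_def half_sum_def parity sum_distrib_left sum_subtractf[symmetric] a_def g_def
      by (intro sum.cong refl) (simp add: algebra_simps)
    also have "\<dots> = (\<Sum>n=1..N. a n) * g 1 + (\<Sum>l=1..<N. (\<Sum>n=Suc l..N. a n) * (g (Suc l) - g l))"
      by (rule abel_summation)
    also have "norm \<dots> \<le> \<bar>\<Sum>n=1..N. a n\<bar> * \<bar>g 1\<bar> + (\<Sum>l=1..<N. \<bar>\<Sum>n=Suc l..N. a n\<bar> * \<bar>g (Suc l) - g l\<bar>)"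
      unfolding real_norm_def
      by (intro order_trans[OF abs_triangle_ineq] add_mono order_trans[OF sum_abs])
         (simp_all add: abs_mult)
    also have "\<dots> \<le> ?K * 2 * (1 / real N) + (\<Sum>l=1..<N. ?K * 2 * real j / real N * (1 / real (N - l)))"
    proof (intro add_mono sum_mono)
      \<comment> \<open>At \<open>m = 1\<close> the upper cut-off is exactly \<open>N\<close>, so
        only one term of the power sum remains.\<close>
      have "g 1 = - (power_sum s j N - power_sum s j (N - 1))"
        by (simp add: g_def)
      also have "power_sum s j N - power_sum s j (N - 1) = s ^ N / real N ^ j"
        using N by (subst power_sum_diff) auto
      finally have "\<bar>g 1\<bar> = 1 / real N ^ j"
        using s by (auto simp: abs_mult power_abs)
      also have "\<dots> \<le> 1 / real N ^ 1"
        using N j by (intro divide_left_mono power_increasing) auto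
      finally have "\<bar>g 1\<bar> \<le> 1 / real N" by simp
      moreover have "\<bar>\<Sum>n=1..N. a n\<bar> \<le> ?K * 2" using tail[of 1 N] by simp
      ultimately show "\<bar>\<Sum>n=1..N. a n\<bar> * \<bar>g 1\<bar> \<le> ?K * 2 * (1 / real N)"
        by (intro mult_mono) auto
    next
      fix l assume l: "l \<in> {1..<N}"
      have "g (Suc l) - g l = (power_sum s j (N + l) - power_sum s j (N + l - 1))
          - (power_sum s j (N - l) - power_sum s j (N - Suc l))"
        by (simp add: g_def)
      also have "power_sum s j (N + l) - power_sum s j (N + l - 1) = s ^ (N + l) / real (N + l) ^ j"
        using l by (subst power_sum_diff) auto
      also have "power_sum s j (N - l) - power_sum s j (N - Suc l) = s ^ (N - l) / real (N - l) ^ j"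
        using l by (subst power_sum_diff) (auto simp: Suc_diff_Suc)
      \<comment> \<open>Equal parity of the two exponents makes the increment a difference of
        powers, hence small.\<close>
      also have "s ^ (N - l) = s ^ (N + l)"
        using s l by (auto simp: minus_one_power_iff)
      finally have "g (Suc l) - g l = - (s ^ (N + l) * ((1 / real (N - l)) ^ j - (1 / real (N + l)) ^ j))"
        by (simp add: algebra_simps power_divide)
      moreover have "(1 / real (N + l)) ^ j \<le> (1 / real (N - l)) ^ j"
        using l by (intro power_mono divide_left_mono) auto
      ultimately have "\<bar>g (Suc l) - g l\<bar> = (1 / real (N - l)) ^ j - (1 / real (N + l)) ^ j"
        using s by (auto simp: abs_mult power_abs)
      also have "\<dots> \<le> real j * (1 / real (N - l) - 1 / real (N + l))"
        using l by (intro power_diff_le divide_left_mono) auto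
      also have "1 / real (N - l) - 1 / real (N + l) = 2 * real l / (real (N - l) * real (N + l))"
        using l by (simp add: field_simps of_nat_diff)
      also have "real j * \<dots> \<le> real j * (2 * real l / (real (N - l) * real N))"
        using l by (intro mult_left_mono divide_left_mono mult_pos_pos) auto
      finally have "\<bar>g (Suc l) - g l\<bar> \<le> real j * (2 * real l / (real (N - l) * real N))" .
      moreover have "\<bar>\<Sum>n=Suc l..N. a n\<bar> \<le> ?K / real l"
        using l by (intro order_trans[OF tail] divide_left_mono) auto
      ultimately have "\<bar>\<Sum>n=Suc l..N. a n\<bar> * \<bar>g (Suc l) - g l\<bar>
          \<le> ?K / real l * (real j * (2 * real l / (real (N - l) * real N)))"
        by (intro mult_mono) auto
      also have "\<dots> = ?K * 2 * real j / real N * (1 / real (N - l))"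
        using l by (simp add: field_simps)
      finally show "\<bar>\<Sum>n=Suc l..N. a n\<bar> * \<bar>g (Suc l) - g l\<bar>
          \<le> ?K * 2 * real j / real N * (1 / real (N - l))" .
    qed
    also have "(\<Sum>l=1..<N. ?K * 2 * real j / real N * (1 / real (N - l)))
        = ?K * 2 * real j / real N * (\<Sum>l=1..<N. 1 / real (N - l))"
      by (simp only: sum_distrib_left)
    also have "(\<Sum>l=1..<N. 1 / real (N - l)) \<le> (harm N :: real)"
    proof -
      have "(\<Sum>l=1..<N. 1 / real (N - l)) = (\<Sum>k=1..<N. 1 / real k)"
        by (rule sum.reindex_bij_witness[of _ "\<lambda>l. N - l" "\<lambda>l. N - l"]) auto
      also have "\<dots> \<le> harm N"
        unfolding harm_def inverse_eq_divide by (intro sum_mono2) auto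
      finally show ?thesis .
    qed
    finally show "norm (folded_sum r i s j N - 2 * power_sum s j N * half_sum r i N)
      \<le> ?K * 2 * (1 / real N) + ?K * 2 * real j * (harm N / real N)"
      using N by (simp add: mult_left_mono divide_right_mono)
  qed
qed

text \<open>The factor \<open>1 + r * (-1) ^ i\<close> is 2 or 0 and so merges the two
  parities.\<close>

lemma folded_sum_asymptotic:
  assumes r: "r = 1 \<or> r = -1" and s: "s = 1 \<or> s = -1" and "i \<ge> 1" "j \<ge> 1"
    and js: "r * (-1) ^ i = -1 \<Longrightarrow> (j, s) \<noteq> (1, 1)"
  shows "(\<lambda>N. folded_sum r i s j N - (1 + r * (-1) ^ i) * power_sum s j N * half_sum r i N) \<longlonglongrightarrow> 0"
proof -
  have "r * (-1) ^ i = 1 \<or> r * (-1) ^ i = -1"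
    using r by (cases "even i") auto
  then show ?thesis
    using folded_sum_right_parity[of r s i j] folded_sum_wrong_parity[of r s i j] assms by auto
qed

subsection \<open>Values in the ring of generators\<close>

text \<open>Doubling the half-integers gives the odd numbers, that is all numbers up to
  \<open>2 * N\<close> without the even ones. The identity is finite, so it also serves the
  divergent exponent 1.\<close>

lemma half_sum_one: "half_sum 1 i N = 2 ^ i * power_sum 1 i (2 * N) - power_sum 1 i N"
proof (induction N)
  case 0
  then show ?case by (simp add: half_sum_def power_sum_def)
next
  case (Suc N)
  have odd: "real (Suc N) - 1/2 = real (Suc (2 * N)) / 2" by simp
  have even: "real (Suc (Suc (2 * N))) = 2 * real (Suc N)" by simp
  have "half_sum 1 i (Suc N) = half_sum 1 i N + 2 ^ i / real (Suc (2 * N)) ^ i"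
    by (simp only: half_sum_def sum.cl_ivl_Suc odd power_divide) simp
  moreover have "power_sum 1 i (2 * Suc N) =
      power_sum 1 i (2 * N) + 1 / real (Suc (2 * N)) ^ i + 1 / (2 ^ i * real (Suc N) ^ i)"
    unfolding mult_Suc_right add_2_eq_Suc power_sum_def
    by (simp only: sum.cl_ivl_Suc even power_mult_distrib) simp
  moreover have "power_sum 1 i (Suc N) = power_sum 1 i N + 1 / real (Suc N) ^ i"
    by (simp add: power_sum_def)
  ultimately show ?case using Suc by (simp add: ring_distribs)
qed

text \<open>The alternating sum is twice its even-indexed part minus the sum without signs.\<close>

lemma power_sum_minus_one_even:
  "power_sum (-1) i (2 * N) = 2 / 2 ^ i * power_sum 1 i N - power_sum 1 i (2 * N)"
proof (induction N)
  case 0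
  then show ?case by (simp add: power_sum_def)
next
  case (Suc N)
  have even: "real (Suc (Suc (2 * N))) = 2 * real (Suc N)" by simp
  have "power_sum s i (2 * Suc N) =
      power_sum s i (2 * N) + s ^ Suc (2 * N) / real (Suc (2 * N)) ^ i + s ^ Suc (Suc (2 * N)) / (2 ^ i * real (Suc N) ^ i)"
    for s
    unfolding mult_Suc_right add_2_eq_Suc power_sum_def
    by (simp only: sum.cl_ivl_Suc even power_mult_distrib) simp
  moreover have "power_sum 1 i (Suc N) = power_sum 1 i N + 1 / real (Suc N) ^ i"
    by (simp add: power_sum_def)
  ultimately show ?case using Suc by (simp add: ring_distribs)
qed

lemma power_sum_minus_one:
  "power_sum (-1) i N = 2 / 2 ^ i * power_sum 1 i (N div 2) - power_sum 1 i N"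
proof (cases "even N")
  case True
  then show ?thesis using power_sum_minus_one_even[of i "N div 2"] by simp
next
  case False
  then obtain M where "N = Suc (2 * M)" by (auto elim: oddE)
  moreover have "power_sum s i (Suc n) = power_sum s i n + s ^ Suc n / real (Suc n) ^ i" for s n
    by (simp add: power_sum_def)
  ultimately show ?thesis using power_sum_minus_one_even[of i M] by simp
qed

lemma half_sum_minus_one:
  "half_sum (-1) i N = - (2 ^ i) * (\<Sum>k<N. (-1) ^ k / (2 * real (Suc k) - 1) ^ i)"
proof (induction N)
  case 0
  then show ?case by (simp add: half_sum_def)
next
  case (Suc N)
  have "real (Suc N) - 1/2 = (2 * real (Suc N) - 1) / 2" by simp
  then have "half_sum (-1) i (Suc N) = half_sum (-1) i N + (-1) ^ Suc N * 2 ^ i / (2 * real (Suc N) - 1) ^ i"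
    by (simp only: half_sum_def sum.cl_ivl_Suc power_divide) simp
  with Suc show ?case by (simp add: ring_distribs)
qed

lemma power_sum_lessThan: "power_sum s j N = (\<Sum>k<N. s ^ Suc k / real (Suc k) ^ j)"
  unfolding power_sum_def by (rule sum.reindex_bij_witness[of _ Suc "\<lambda>k. k - 1"]) auto

lemma power_sum_one_tendsto:
  assumes "j \<ge> 2"
  shows "power_sum 1 j \<longlonglongrightarrow> zeta_value j"
proof -
  have "summable (\<lambda>k. 1 / real (Suc k) ^ j)"
    using assms inverse_power_summable[of j, where ?'a = real]
    by (subst summable_Suc_iff[where f = "\<lambda>k. 1 / real k ^ j"]) (simp add: inverse_eq_divide)
  then show ?thesis
    unfolding zeta_value_def power_sum_lessThan[abs_def] by (simp add: summable_LIMSEQ)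
qed

lemma half_sum_minus_one_tendsto:
  assumes "i \<ge> 1"
  shows "half_sum (-1) i \<longlonglongrightarrow> - (2 ^ i) * dirichlet_beta i"
proof -
  have "summable (\<lambda>k. (-1) ^ k * (1 / (2 * real (Suc k) - 1) ^ i))"
  proof (rule summable_Leibniz(1))
    have bound: "1 / (2 * real (Suc k) - 1) ^ i \<le> 1 / real (Suc k)" for k
    proof -
      have "real (Suc k) \<le> (2 * real (Suc k) - 1) ^ 1" by simp
      also have "\<dots> \<le> (2 * real (Suc k) - 1) ^ i" using assms by (intro power_increasing) auto
      finally show ?thesis by (intro divide_left_mono) auto
    qed
    show "(\<lambda>k. 1 / (2 * real (Suc k) - 1) ^ i) \<longlonglongrightarrow> 0"
      by (rule tendsto_sandwich[OF _ _ tendsto_const LIMSEQ_Suc[OF lim_1_over_n]])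
         (use bound in auto)
    show "monoseq (\<lambda>k. 1 / (2 * real (Suc k) - 1) ^ i)"
      by (rule decseq_imp_monoseq) (auto simp: decseq_def intro!: divide_left_mono power_mono)
  qed
  then show ?thesis
    unfolding dirichlet_beta_def half_sum_minus_one[abs_def]
    by (intro tendsto_mult tendsto_const summable_LIMSEQ) simp
qed

lemma tends_into_ring_double:
  "tends_into_ring f \<Longrightarrow> tends_into_ring (\<lambda>N. f (2 * N))"
  unfolding tends_into_ring_def
  using filterlim_compose[OF _ mult_nat_left_at_top[of 2]] by fastforce

lemma half_sum_one_in_ring:
  assumes "tends_into_ring (power_sum 1 i)"
  shows "tends_into_ring (half_sum 1 i)"
  unfolding half_sum_one[abs_def]
  using assms tends_into_ring_const_int[of "2 ^ i"] tends_into_ring_double[OF assms]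
  by (intro tends_into_ring_diff tends_into_ring_mult) auto

text \<open>For the sign -1 the limit is 0, so single sums matter only for the sign +1. This parity
  selection is what closes the recursions for even zeta and odd beta values.\<close>

lemma folded_sum_in_ring:
  assumes "r = 1 \<or> r = -1" "s = 1 \<or> s = -1" "i \<ge> 1" "j \<ge> 1"
    and "r * (-1) ^ i = -1 \<Longrightarrow> (j, s) \<noteq> (1, 1)"
    and "r * (-1) ^ i = 1 \<Longrightarrow> tends_into_ring (power_sum s j) \<and> tends_into_ring (half_sum r i)"
  shows "tends_into_ring (folded_sum r i s j)"
proof (rule tends_into_ring_cong_limit[OF _ folded_sum_asymptotic[OF assms(1-5)]])
  have "r * (-1) ^ i = 1 \<or> r * (-1) ^ i = -1"
    using assms(1) by (cases "even i") auto
  then show "tends_into_ring (\<lambda>N. (1 + r * (-1) ^ i) * power_sum s j N * half_sum r i N)"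
    using assms(6) tends_into_ring_const_int[of 2] tends_into_ring_const_int[of 0]
      tends_into_ring_mult by fastforce
qed

lemma sign_in_ring:
  assumes "s = 1 \<or> s = -1"
  shows "tends_into_ring (\<lambda>_. s)"
  using assms tends_into_ring_const_int[of 1] tends_into_ring_const_int[of "-1"] by auto

lemma minus_one_power_in_ring: "tends_into_ring (\<lambda>_. (-1) ^ q)"
  using tends_into_ring_const_int[of "(-1) ^ q"] by simp

lemma bilateral_sum_in_ring:
  assumes s1: "s1 = 1 \<or> s1 = -1" and s2: "s2 = 1 \<or> s2 = -1" and "p + q \<ge> 1"
    and "\<And>i. i \<in> {1..q} \<Longrightarrow> tends_into_ring (folded_sum (s1 * s2) i s1 (p + q - i))"
    and "\<And>i. i \<in> {1..p} \<Longrightarrow> tends_into_ring (folded_sum (s1 * s2) i s2 (p + q - i))"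
  shows "tends_into_ring (bilateral_sum p q s1 s2)"
proof -
  obtain c d :: "nat \<Rightarrow> int" where "\<And>N. bilateral_sum p q s1 s2 N =
        (\<Sum>i=1..q. of_int (c i) * folded_sum (s1 * s2) i s1 (p + q - i) N)
      + (\<Sum>i=1..p. of_int (d i) * (s1 * s2 * (-1) ^ i * folded_sum (s1 * s2) i s2 (p + q - i) N))"
    using bilateral_sum_partial_fractions[OF s1 s2 assms(3)] by blast
  then have eq: "bilateral_sum p q s1 s2 = (\<lambda>N.
        (\<Sum>i=1..q. of_int (c i) * folded_sum (s1 * s2) i s1 (p + q - i) N)
      + (\<Sum>i=1..p. of_int (d i) * (s1 * s2 * (-1) ^ i * folded_sum (s1 * s2) i s2 (p + q - i) N)))"
    by blast
  show ?thesis
    unfolding eq using assms(4,5) sign_in_ring[OF s1] sign_in_ring[OF s2] minus_one_power_in_ring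
    by (intro tends_into_ring_add tends_into_ring_sum tends_into_ring_mult tends_into_ring_const_int) auto
qed

text \<open>When the weight has the other parity, the double sums cancel, and the same identity
  expresses the diagonal sum of weight \<open>p + q\<close> through sums of lower weight.\<close>

lemma diagonal_in_ring:
  assumes s1: "s1 = 1 \<or> s1 = -1" and s2: "s2 = 1 \<or> s2 = -1"
    and "s1 * s2 * (-1) ^ (p + q) = 1"
    and "tends_into_ring (half_sum s1 p)" "tends_into_ring (half_sum s2 q)"
    and "tends_into_ring (bilateral_sum p q s1 s2)"
  shows "tends_into_ring (half_sum (s1 * s2) (p + q))"
proof -
  have "half_sum (s1 * s2) (p + q) N = half_sum s1 p N * half_sum s2 q N
      + s2 * (-1) ^ q * (half_sum s1 p N * half_sum s2 q N) - bilateral_sum p q s1 s2 N" for N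
    using bilateral_sum_by_sign[OF s1 s2, of p q N] stuffle_product[of p q s1 s2 N] assms(3) by simp
  then have eq: "half_sum (s1 * s2) (p + q) = (\<lambda>N. half_sum s1 p N * half_sum s2 q N
      + s2 * (-1) ^ q * (half_sum s1 p N * half_sum s2 q N) - bilateral_sum p q s1 s2 N)"
    by blast
  show ?thesis
    unfolding eq using assms(4-6) sign_in_ring[OF s2] minus_one_power_in_ring
    by (intro tends_into_ring_add tends_into_ring_diff tends_into_ring_mult) auto
qed

section \<open>Zeta, alternating zeta and beta values\<close>

text \<open>Recursion from the value at 2: in the diagonal identity with both signs 1, folded sums
  with odd \<open>i\<close> vanish, and those with even \<open>i\<close> involve only even exponents
  below \<open>w\<close>.\<close>

lemma even_zeta_in_ring:
  assumes "even w" "w \<ge> 2"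
  shows "rat_polynomial_in t_generators (zeta_value w)"
  using assms
proof (induction w rule: less_induct)
  case (less w)
  have pi: "rat_polynomial_in t_generators pi"
    by (rule rat_polynomial_in_generator) (simp add: t_generators_def)
  show ?case
  proof (cases "w = 2")
    case True
    have "zeta_value 2 = pi\<^sup>2 / 6"
      using sums_unique[OF inverse_squares_sums] by (simp add: zeta_value_def add.commute)
    then have "zeta_value 2 = of_rat (1/6) * (pi * pi)"
      by (simp add: of_rat_divide power2_eq_square)
    then show ?thesis
      unfolding True using pi by (auto intro!: rat_polynomial_in_mult rat_polynomial_in_of_rat)
  next
    case False
    with less.prems have w: "w \<ge> 4" "even w" "2 \<le> w" by presburger+
    have IH: "tends_into_ring (power_sum 1 v)" "tends_into_ring (half_sum 1 v)"
      if "even v" "2 \<le> v" "v < w" for v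
      using less.IH[of v] that half_sum_one_in_ring tends_into_ringI[OF power_sum_one_tendsto] by blast+
    have folded: "tends_into_ring (folded_sum 1 i 1 (w - i))" if i: "1 \<le> i" "i \<le> w - 2" for i
    proof (rule folded_sum_in_ring)
      assume "1 * (-1) ^ i = (1 :: real)"
      then have "even i" by (simp add: minus_one_power_iff split: if_splits)
      with i w show "tends_into_ring (power_sum 1 (w - i)) \<and> tends_into_ring (half_sum 1 i)"
        by (intro conjI IH) auto
    qed (use i w in auto)
    \<comment> \<open>Splitting \<open>w\<close> as \<open>(w - 2) + 2\<close> keeps every exponent
      \<open>w - i\<close> at least 2, so no harmonic sum occurs.\<close>
    have "tends_into_ring (half_sum (1 * 1) (w - 2 + 2))"
    proof (rule diagonal_in_ring)
      show "tends_into_ring (bilateral_sum (w - 2) 2 1 1)"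
      proof (rule bilateral_sum_in_ring)
        fix i :: nat assume "i \<in> {1..2}"
        moreover from this have "i \<le> w - 2" using w by auto
        ultimately show "tends_into_ring (folded_sum (1 * 1) i 1 (w - 2 + 2 - i))"
          unfolding mult_1 le_add_diff_inverse2[OF w(3)] by (intro folded) auto
      next
        fix i assume "i \<in> {1..w - 2}"
        then show "tends_into_ring (folded_sum (1 * 1) i 1 (w - 2 + 2 - i))"
          unfolding mult_1 le_add_diff_inverse2[OF w(3)] by (intro folded) auto
      qed (use w in auto)
    qed (use w IH in auto)
    then have "tends_into_ring (half_sum 1 w)"
      unfolding mult_1 le_add_diff_inverse2[OF w(3)] .
    then obtain L where L: "half_sum 1 w \<longlonglongrightarrow> L" "rat_polynomial_in t_generators L"
      unfolding tends_into_ring_def by blast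
    have lim: "power_sum 1 w \<longlonglongrightarrow> zeta_value w" using w by (intro power_sum_one_tendsto) auto
    then have "(\<lambda>N. power_sum 1 w (2 * N)) \<longlonglongrightarrow> zeta_value w"
      by (rule filterlim_compose) (simp add: mult_nat_left_at_top)
    with lim have "half_sum 1 w \<longlonglongrightarrow> 2 ^ w * zeta_value w - zeta_value w"
      unfolding half_sum_one[abs_def] by (intro tendsto_intros)
    then have "L = 2 ^ w * zeta_value w - zeta_value w"
      using L(1) LIMSEQ_unique by blast
    moreover have "(2 :: real) ^ w - 1 \<noteq> 0"
    proof -
      have "(1 :: real) < 2 ^ w" by (rule one_less_power) (use w in auto)
      then show ?thesis by linarith
    qed
    ultimately have "zeta_value w = of_rat (1 / (2 ^ w - 1)) * L"
      by (simp add: of_rat_divide of_rat_diff of_rat_power field_simps)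
    with L(2) show ?thesis
      by (auto intro!: rat_polynomial_in_mult rat_polynomial_in_of_rat)
  qed
qed

lemma zeta_in_ring:
  assumes "w \<ge> 2"
  shows "rat_polynomial_in t_generators (zeta_value w)"
proof (cases "even w")
  case False
  then obtain k where "w = 2 * k + 1" by (elim oddE)
  with assms show ?thesis
    by (intro rat_polynomial_in_generator) (auto simp: t_generators_def)
qed (use even_zeta_in_ring assms in blast)

lemma power_sum_minus_one_tendsto:
  assumes "j \<ge> 2"
  shows "power_sum (-1) j \<longlonglongrightarrow> 2 / 2 ^ j * zeta_value j - zeta_value j"
proof -
  have lim: "power_sum 1 j \<longlonglongrightarrow> zeta_value j" using assms by (rule power_sum_one_tendsto)
  then have "(\<lambda>N. power_sum 1 j (N div 2)) \<longlonglongrightarrow> zeta_value j"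
    by (rule filterlim_compose) (simp add: filterlim_at_top_div_const_nat)
  with lim show ?thesis
    unfolding power_sum_minus_one[abs_def] by (intro tendsto_intros)
qed

text \<open>The generator \<open>ln 2\<close> enters here, through the alternating harmonic
  series.\<close>

lemma power_sum_in_ring:
  assumes "s = 1 \<or> s = -1" "j \<ge> 1" "(j, s) \<noteq> (1, 1)"
  shows "tends_into_ring (power_sum s j)"
proof -
  consider "j \<ge> 2" "s = 1" | "j \<ge> 2" "s = -1" | "j = 1" "s = -1"
    using assms by (cases "j = 1") auto
  then show ?thesis
  proof cases
    case 1
    then show ?thesis
      using tends_into_ringI[OF power_sum_one_tendsto zeta_in_ring] by simp
  next
    case 2
    then have "rat_polynomial_in t_generators (of_rat (2 / 2 ^ j - 1) * zeta_value j)"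
      by (intro rat_polynomial_in_mult rat_polynomial_in_of_rat zeta_in_ring)
    then have "rat_polynomial_in t_generators (2 / 2 ^ j * zeta_value j - zeta_value j)"
      by (simp add: of_rat_divide of_rat_diff of_rat_power left_diff_distrib)
    with 2 show ?thesis
      using tends_into_ringI[OF power_sum_minus_one_tendsto] by simp
  next
    case 3
    have "(\<lambda>N. - (\<Sum>k<N. (-1) ^ k / real (Suc k))) \<longlonglongrightarrow> - ln 2"
      using alternating_harmonic_series_sums unfolding sums_def by (rule tendsto_minus)
    then have "power_sum (-1) 1 \<longlonglongrightarrow> - ln 2"
      unfolding power_sum_lessThan[abs_def] by (simp add: sum_negf)
    moreover have "rat_polynomial_in t_generators (of_rat (-1) * ln 2)"
      by (intro rat_polynomial_in_mult rat_polynomial_in_of_rat rat_polynomial_in_generator)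
         (simp add: t_generators_def)
    ultimately show ?thesis using 3 by (auto intro: tends_into_ringI)
  qed
qed

text \<open>Even beta values are generators and the first one is \<open>pi / 4\<close>; the other
  odd ones follow recursively from the diagonal identity.\<close>

lemma half_sum_minus_one_in_ring:
  assumes "w \<ge> 1"
  shows "tends_into_ring (half_sum (-1) w)"
  using assms
proof (induction w rule: less_induct)
  case (less w)
  have scaled: "tends_into_ring (half_sum (-1) v)"
    if "v \<ge> 1" "rat_polynomial_in t_generators (dirichlet_beta v)" for v
  proof -
    have "rat_polynomial_in t_generators (of_rat (- (2 ^ v)) * dirichlet_beta v)"
      using that by (intro rat_polynomial_in_mult rat_polynomial_in_of_rat)
    then show ?thesis
      using tends_into_ringI[OF half_sum_minus_one_tendsto] that
      by (simp add: of_rat_minus of_rat_power)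
  qed
  consider "w = 1" | "w = 2" | k where "w = 2 * k" "k \<ge> 2" | "odd w" "w \<ge> 3"
  proof -
    have "w = 1 \<or> w = 2 \<or> (\<exists>k. w = 2 * k \<and> k \<ge> 2) \<or> odd w \<and> w \<ge> 3"
      using less.prems by presburger
    then show ?thesis using that by blast
  qed
  then show ?case
  proof cases
    case 1
    have "pi / 4 = dirichlet_beta 1"
      unfolding pi_series dirichlet_beta_def by (intro suminf_cong) (simp add: algebra_simps)
    then have "dirichlet_beta 1 = of_rat (1/4) * pi" by (simp add: of_rat_divide)
    moreover have "rat_polynomial_in t_generators (of_rat (1/4) * pi)"
      by (intro rat_polynomial_in_mult rat_polynomial_in_of_rat rat_polynomial_in_generator)
         (simp add: t_generators_def)
    ultimately have "rat_polynomial_in t_generators (dirichlet_beta 1)" by simp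
    then show ?thesis using scaled 1 by simp
  next
    case 2
    have "rat_polynomial_in t_generators (dirichlet_beta 2)"
      by (intro rat_polynomial_in_generator) (simp add: t_generators_def catalan_const_def)
    then show ?thesis using scaled 2 by simp
  next
    case 3
    then have "rat_polynomial_in t_generators (dirichlet_beta w)"
      by (intro rat_polynomial_in_generator) (auto simp: t_generators_def)
    then show ?thesis using scaled less.prems by simp
  next
    case 4
    have one: "tends_into_ring (power_sum 1 (w - 1))"
      using 4 by (intro power_sum_in_ring) auto
    \<comment> \<open>With signs 1 and -1 the exponents are \<open>w - 1\<close> and 1: the exponent
      1 always meets the sign -1 and stays convergent.\<close>
    have "tends_into_ring (half_sum (1 * -1) (w - 1 + 1))"
    proof (rule diagonal_in_ring)
      show "tends_into_ring (bilateral_sum (w - 1) 1 1 (-1))"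
      proof (rule bilateral_sum_in_ring)
        fix i :: nat assume "i \<in> {1..1}"
        then show "tends_into_ring (folded_sum (1 * -1) i 1 (w - 1 + 1 - i))"
          using 4 one less.IH[of 1] by (intro folded_sum_in_ring) auto
      next
        fix i assume i: "i \<in> {1..w - 1}"
        then show "tends_into_ring (folded_sum (1 * -1) i (-1) (w - 1 + 1 - i))"
          using 4 less.IH[of i] by (intro folded_sum_in_ring conjI impI power_sum_in_ring) auto
      qed auto
    qed (use 4 one less.IH[of 1] half_sum_one_in_ring in auto)
    then show ?thesis using 4 by simp
  qed
qed

lemma half_sum_in_ring:
  assumes "s = 1 \<or> s = -1" "i \<ge> 1" "(i, s) \<noteq> (1, 1)"
  shows "tends_into_ring (half_sum s i)"
proof (cases "s = 1")
  case True
  with assms show ?thesis using half_sum_one_in_ring[of i] power_sum_in_ring[of 1 i] by simp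
next
  case False
  with assms show ?thesis using half_sum_minus_one_in_ring[of i] by simp
qed

section \<open>Reduction of the double sums\<close>

lemma folded_sum_in_ring_of_convergent:
  assumes "r = 1 \<or> r = -1" "s = 1 \<or> s = -1" "i \<ge> 1" "j \<ge> 1" "(j, s) \<noteq> (1, 1)"
  shows "tends_into_ring (folded_sum r i s j)"
proof (rule folded_sum_in_ring)
  assume "r * (-1) ^ i = 1"
  then have "(i, r) \<noteq> (1, 1)" by auto
  with assms show "tends_into_ring (power_sum s j) \<and> tends_into_ring (half_sum r i)"
    by (intro conjI power_sum_in_ring half_sum_in_ring)
qed (use assms in auto)

text \<open>If \<open>q = 1\<close> and \<open>s2 = 1\<close>, then \<^term>\<open>half_sum s2 q\<close> and the last partial-fraction term of the
  bilateral sum both diverge logarithmically, and their divergences cancel up to \<open>ln 2\<close>.\<close>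

lemma bilateral_plus_product_in_ring:
  assumes s1: "s1 = 1 \<or> s1 = -1" and p: "p \<ge> 1" "(p, s1) \<noteq> (1, 1)"
    and parity: "s1 * (-1) ^ p = 1"
  shows "tends_into_ring (\<lambda>N. bilateral_sum p 1 s1 1 N + 2 * (half_sum s1 p N * half_sum 1 1 N))"
proof -
  have sign1: "(1 :: real) = 1 \<or> (1 :: real) = -1" by simp
  obtain c d :: "nat \<Rightarrow> int" where d: "d p = (-1) ^ 1" and
    eq: "\<And>N. bilateral_sum p 1 s1 1 N =
        (\<Sum>i=1..1. of_int (c i) * folded_sum (s1 * 1) i s1 (p + 1 - i) N)
      + (\<Sum>i=1..p. of_int (d i) * (s1 * 1 * (-1) ^ i * folded_sum (s1 * 1) i 1 (p + 1 - i) N))"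
    using bilateral_sum_partial_fractions[OF s1 sign1 le_add2] by blast
  define rest where "rest N = (\<Sum>i=1..1. of_int (c i) * folded_sum s1 i s1 (p + 1 - i) N)
      + (\<Sum>i\<in>{1..p} - {p}. of_int (d i) * (s1 * (-1) ^ i * folded_sum s1 i 1 (p + 1 - i) N))" for N
  have split: "(\<Sum>i=1..p. f i) = (\<Sum>i\<in>{1..p} - {p}. f i) + f p" for f :: "nat \<Rightarrow> real"
    using p by (subst sum.remove[of _ p]) auto
  \<comment> \<open>The coefficient is \<open>d p\<close> times the parity sign, hence exactly
    -1.\<close>
  have bil: "bilateral_sum p 1 s1 1 N = rest N - folded_sum s1 p 1 1 N" for N
    unfolding eq split rest_def using d parity by simp
  have rest: "tends_into_ring rest"
  proof -
    have "tends_into_ring (folded_sum s1 i s1 (p + 1 - i))" if "i \<in> {1..1}" for i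
      using that s1 p by (intro folded_sum_in_ring_of_convergent) auto
    moreover have "tends_into_ring (folded_sum s1 i 1 (p + 1 - i))" if "i \<in> {1..p} - {p}" for i
      using that s1 by (intro folded_sum_in_ring_of_convergent) auto
    ultimately show ?thesis
      unfolding rest_def[abs_def] using sign_in_ring[OF s1] minus_one_power_in_ring
      by (intro tends_into_ring_add tends_into_ring_sum tends_into_ring_mult tends_into_ring_const_int) auto
  qed
  \<comment> \<open>The harmonic parts cancel exactly; what is left tends to
    \<open>2 * ln 2\<close>.\<close>
  have harmonic: "half_sum 1 1 N - power_sum 1 1 N = - 2 * power_sum (-1) 1 (2 * N)" for N
    by (simp add: half_sum_one power_sum_minus_one_even)
  have log: "tends_into_ring (\<lambda>N. half_sum 1 1 N - power_sum 1 1 N)"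
    unfolding harmonic
    using tends_into_ring_mult[OF tends_into_ring_const_int[of "-2"]
        tends_into_ring_double[OF power_sum_in_ring[of "-1" 1]]] by simp
  show ?thesis
  proof (rule tends_into_ring_cong_limit)
    show "tends_into_ring (\<lambda>N. rest N + 2 * (half_sum s1 p N * (half_sum 1 1 N - power_sum 1 1 N)))"
      using rest log half_sum_in_ring[OF s1 p] tends_into_ring_const_int[of 2]
      by (intro tends_into_ring_add tends_into_ring_mult) auto
    have "(\<lambda>N. - (folded_sum s1 p 1 1 N - 2 * power_sum 1 1 N * half_sum s1 p N)) \<longlonglongrightarrow> - 0"
      using p by (intro tendsto_minus folded_sum_right_parity[OF s1 sign1 _ parity]) auto
    then show "(\<lambda>N. bilateral_sum p 1 s1 1 N + 2 * (half_sum s1 p N * half_sum 1 1 N)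
        - (rest N + 2 * (half_sum s1 p N * (half_sum 1 1 N - power_sum 1 1 N)))) \<longlonglongrightarrow> 0"
      unfolding bil by (simp add: algebra_simps)
  qed
qed

text \<open>Under this parity the sign evaluation contains the difference of the two double sums,
  and the stuffle relation their sum; adding them isolates twice
  \<open>double_sum p q s1 s2\<close>.\<close>

lemma double_sum_in_ring:
  assumes s1: "s1 = 1 \<or> s1 = -1" and s2: "s2 = 1 \<or> s2 = -1" and pq: "p \<ge> 1" "q \<ge> 1"
    and p1: "(p, s1) \<noteq> (1, 1)" and parity: "s1 * s2 * (-1) ^ (p + q) = -1"
  shows "tends_into_ring (double_sum p q s1 s2)"
proof -
  have r: "s1 * s2 = 1 \<or> s1 * s2 = -1" using s1 s2 by auto
  \<comment> \<open>For \<open>(q, s2) = (1, 1)\<close> the factor is 2, and the two summands are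
    treated together since the product may diverge.\<close>
  let ?B = "\<lambda>N. bilateral_sum p q s1 s2 N + (1 - s2 * (-1) ^ q) * (half_sum s1 p N * half_sum s2 q N)"
  have B: "tends_into_ring ?B"
  proof (cases "(q, s2) = (1, 1)")
    case True
    with parity have "s1 * (-1) ^ p = 1" by simp
    with True show ?thesis using bilateral_plus_product_in_ring[OF s1 pq(1) p1] by simp
  next
    case False
    have "tends_into_ring (bilateral_sum p q s1 s2)"
    proof (rule bilateral_sum_in_ring[OF s1 s2])
      \<comment> \<open>The least exponent is \<open>p\<close>, reached at \<open>i = q\<close>, so
        \<open>p1\<close> excludes the divergent case; for the other family \<open>False\<close>
        does so at \<open>i = p\<close>.\<close>
      show "tends_into_ring (folded_sum (s1 * s2) i s1 (p + q - i))" if "i \<in> {1..q}" for i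
        using that pq p1 by (intro folded_sum_in_ring_of_convergent[OF r s1]) auto
      show "tends_into_ring (folded_sum (s1 * s2) i s2 (p + q - i))" if "i \<in> {1..p}" for i
        using that pq False by (intro folded_sum_in_ring_of_convergent[OF r s2]) auto
    qed (use pq in simp)
    then show ?thesis
      using half_sum_in_ring[OF s1 pq(1) p1] half_sum_in_ring[OF s2 pq(2) False]
        sign_in_ring[OF s2] minus_one_power_in_ring tends_into_ring_const_int[of 1]
      by (intro tends_into_ring_add tends_into_ring_mult tends_into_ring_diff) auto
  qed
  have "double_sum p q s1 s2 N = of_rat (1/2) * (?B N - half_sum (s1 * s2) (p + q) N)" for N
    using bilateral_sum_by_sign[OF s1 s2, of p q N, unfolded parity] stuffle_product[of p q s1 s2 N]
    by (simp add: of_rat_divide field_simps)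
  then have eq: "double_sum p q s1 s2 = (\<lambda>N. of_rat (1/2) * (?B N - half_sum (s1 * s2) (p + q) N))"
    by blast
  have "tends_into_ring (half_sum (s1 * s2) (p + q))"
    using pq by (intro half_sum_in_ring[OF r]) auto
  then show ?thesis
    unfolding eq by (intro tends_into_ring_mult tends_into_ring_const_rat tends_into_ring_diff B)
qed

theorem theorem3p5:
  fixes p q :: nat and \<sigma>1 \<sigma>2 :: int
  assumes "p \<ge> 1" and "q \<ge> 1"
    and "\<sigma>1 \<in> {1, -1}" and "\<sigma>2 \<in> {1, -1}"
    and "(p, \<sigma>1) \<noteq> (1, 1)"
    and "even (p + q) \<longleftrightarrow> even ((1 + \<sigma>1 * \<sigma>2) div 2)"
  shows "rat_polynomial_in t_generators (double_t p q \<sigma>1 \<sigma>2) \<and>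
         rat_polynomial_in t_generators (double_t_tilde p q \<sigma>1 \<sigma>2)"
proof -
  let ?s1 = "real_of_int \<sigma>1" and ?s2 = "real_of_int \<sigma>2"
  have s1: "?s1 = 1 \<or> ?s1 = -1" and s2: "?s2 = 1 \<or> ?s2 = -1" using assms(3,4) by auto
  \<comment> \<open>The half-sum in the parity condition is 1 or 0 as the product of the signs is 1
    or -1, so the weight is odd in the first case and even in the second.\<close>
  have "?s1 * ?s2 * (-1) ^ (p + q) = -1"
    using assms(3,4,6) by (auto simp: minus_one_power_iff)
  moreover have "(p, ?s1) \<noteq> (1, 1)" using assms(5) by auto
  ultimately have "tends_into_ring (double_sum p q ?s1 ?s2)"
    using assms(1,2) by (intro double_sum_in_ring s1 s2)
  then obtain L where lim: "double_sum p q ?s1 ?s2 \<longlonglongrightarrow> L" and L: "rat_polynomial_in t_generators L"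
    unfolding tends_into_ring_def by blast
  define f where "f n = (\<Sum>m=1..<n. ?s1 ^ n * ?s2 ^ m / ((real n - 1/2) ^ p * (real m - 1/2) ^ q))" for n
  have "(\<Sum>n\<le>N. f n) = double_sum p q ?s1 ?s2 N" for N
  proof -
    \<comment> \<open>The index 0 contributes an empty inner sum.\<close>
    have "{..N} = insert 0 {1..N}" by auto
    then show ?thesis by (simp add: double_sum_def f_def)
  qed
  with lim have f: "f sums L" by (simp add: sums_def_le)
  then have tilde: "double_t_tilde p q \<sigma>1 \<sigma>2 = L"
    unfolding double_t_tilde_def f_def by (simp add: sums_iff)
  have "double_t p q \<sigma>1 \<sigma>2 = L / 2 ^ (p + q)"
  proof -
    have "(2 * x - 1) ^ k = 2 ^ k * (x - 1/2) ^ k" for x :: real and k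
      unfolding power_mult_distrib[symmetric] by simp
    then have "(\<lambda>n. \<Sum>m=1..<n. ?s1 ^ n * ?s2 ^ m / ((2 * real n - 1) ^ p * (2 * real m - 1) ^ q))
        = (\<lambda>n. f n / 2 ^ (p + q))"
      by (simp add: f_def sum_divide_distrib power_add mult_ac)
    then show ?thesis
      unfolding double_t_def using sums_divide[OF f, of "2 ^ (p + q)"] by (simp add: sums_iff)
  qed
  then have "double_t p q \<sigma>1 \<sigma>2 = of_rat (1 / 2 ^ (p + q)) * L"
    by (simp add: of_rat_divide of_rat_power)
  with tilde L show ?thesis
    by (auto intro!: rat_polynomial_in_mult rat_polynomial_in_of_rat)
qed

end
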